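(* Let $0<\alpha<1$ and let $u_0\in L^1([0,+\infty))\cap L^\infty([0,+\infty))$ be nonnegative, $u_0\not\equiv0$, and radially non-increasing (that is, non-increasing as a function of the volume variable $\rho\ge0$). Let $m_0(\rho)=\int_0^\rho u_0(s)\,ds$. For every $t>0$, the map $$P_t:\bigcup_{\rho_0:\,u_0(\rho_0)>0}\{\rho_0\}\times\bigl[u_0(\rho_0^+),u_0(\rho_0^-)\bigr]\longrightarrow\mathbb R_+,\qquad P_t(\rho_0,\eta_0)=\rho_0+\alpha\,m_0(\rho_0)\,\eta_0^{\alpha-1}\,t,$$ is bijective. Therefore, the function $$u(t,\rho)=\bigl(\eta_0^{-\alpha}+\alpha t\bigr)^{-\frac1\alpha},\qquad\text{where }\rho=\rho_0+\alpha\,m_0(\rho_0)\,\eta_0^{\alpha-1}\,t\ \text{ and }\ \eta_0\in\bigl[u_0(\rho_0^+),u_0(\rho_0^-)\bigr],$$ is well defined. Furthermore, it defines a function $u\in\mathcal C([0,+\infty)^2)$ such that $u(t,\cdot)\to u_0$ in $L^1(\mathbb R^d)$ as $t\to0$. The function $m$ given by $$m(t,\rho)=m_0(\rho_0)\bigl(1+\alpha\eta_0^\alpha t\bigr)^{1-\frac1\alpha},\qquad\text{where }(\rho_0,\eta_0)=P_t^{-1}(\rho),$$ is a classical solution, by characteristics, of $m_t+m\,(m_\rho)^\alpha=0$.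
   Context: $u_0(\rho_0^\pm)$ denote the one-sided limits of the monotone function $u_0$ at $\rho_0$ (at $\rho_0=0$ only the right limit is meant, i.e. $u_0(0^-):=u_0(0^+)$), and $\mathbb R_+=[0,+\infty)$. A radial function on $\mathbb R^d$ is identified with a function of the volume variable $\rho=\omega_d|x|^d$, where $\omega_d$ is the volume of the unit ball of $\mathbb R^d$.
   Formalization: In the domain of P_t, u_0(ρ_0)>0 is read as u_0(ρ_0^-)>0 and η_0=0 is excluded; u_0≢0 is meant a.e.; u is continuous for t>0 and at (0,ρ) where u_0 is continuous, hence on [0,∞)^2 if u_0 is continuous (false if u_0 jumps, e.g. 1_[0,1]). *)

theory Defs
  imports "HOL-Analysis.Analysis"
begin

text \<open>
  Functions of the volume variable \<open>\<rho> \<ge> 0\<close> are functions \<open>real \<Rightarrow> real\<close>;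
  their values at negative arguments are irrelevant.
\<close>

definition radial :: "(real \<Rightarrow> real) \<Rightarrow> 'a::euclidean_space \<Rightarrow> real" where
  "radial f x = f (unit_ball_vol (real DIM('a)) * norm x ^ DIM('a))"

definition right_lim :: "(real \<Rightarrow> real) \<Rightarrow> real \<Rightarrow> real" where
  "right_lim f \<rho> = Lim (at_right \<rho>) f"

definition left_lim :: "(real \<Rightarrow> real) \<Rightarrow> real \<Rightarrow> real" where
  "left_lim f \<rho> = (if \<rho> = 0 then Lim (at_right 0) f else Lim (at_left \<rho>) f)"

definition mass :: "(real \<Rightarrow> real) \<Rightarrow> real \<Rightarrow> real" where
  "mass u0 \<rho> = (LBINT s:{0..\<rho>}. u0 s)"

text \<open>
  The domain of the characteristic map. The function \<open>u0\<close> stands for an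
  \<open>L\<^sup>1\<close> class, so the condition \<open>u0 \<rho>0 > 0\<close> on the
  base points must not depend on the value chosen at a jump (it matters only when \<open>u0\<close> jumps
  to zero at the end of its support); it is read as \<open>u0(\<rho>0\<^sup>-) > 0\<close>, i.e. for
  the left-continuous representative. The value \<open>\<eta>0 = 0\<close>, which lies in the interval
  at such a jump, is removed: there \<open>\<eta>0 powr (\<alpha> - 1)\<close> stands for \<open>+\<infinity>\<close> on
  paper, whereas \<open>0 powr (\<alpha> - 1) = 0\<close> in HOL.
\<close>

definition char_dom :: "(real \<Rightarrow> real) \<Rightarrow> (real \<times> real) set" where
  "char_dom u0 =
     (\<Union>\<rho>0\<in>{\<rho>0. 0 \<le> \<rho>0 \<and> 0 < left_lim u0 \<rho>0}.
        {\<rho>0} \<times> ({right_lim u0 \<rho>0..left_lim u0 \<rho>0} - {0}))"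

lemma char_dom_left_continuous:
  assumes "\<And>\<rho>. 0 \<le> \<rho> \<Longrightarrow> u0 \<rho> = left_lim u0 \<rho>"
  shows "char_dom u0 =
     (\<Union>\<rho>0\<in>{\<rho>0. 0 \<le> \<rho>0 \<and> 0 < u0 \<rho>0}. {\<rho>0} \<times> ({right_lim u0 \<rho>0..left_lim u0 \<rho>0} - {0}))"
  using assms unfolding char_dom_def by (intro SUP_cong) auto

definition char_map :: "real \<Rightarrow> (real \<Rightarrow> real) \<Rightarrow> real \<Rightarrow> real \<times> real \<Rightarrow> real" where
  "char_map \<alpha> u0 t = (\<lambda>(\<rho>0, \<eta>0). \<rho>0 + \<alpha> * mass u0 \<rho>0 * \<eta>0 powr (\<alpha> - 1) * t)"

definition char_inv :: "real \<Rightarrow> (real \<Rightarrow> real) \<Rightarrow> real \<Rightarrow> real \<Rightarrow> real \<times> real" where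
  "char_inv \<alpha> u0 t = the_inv_into (char_dom u0) (char_map \<alpha> u0 t)"

text \<open>
  For \<open>t > 0\<close> the next two functions are given by the formulas along characteristics. At
  \<open>t = 0\<close> the map is \<open>(\<rho>0, \<eta>0) \<mapsto> \<rho>0\<close>, which need not be injective, and
  the initial data are used instead.
\<close>

definition u_sol :: "real \<Rightarrow> (real \<Rightarrow> real) \<Rightarrow> real \<Rightarrow> real \<Rightarrow> real" where
  "u_sol \<alpha> u0 t \<rho> =
     (if t = 0 then u0 \<rho>
      else (case char_inv \<alpha> u0 t \<rho> of (\<rho>0, \<eta>0) \<Rightarrow>
              (\<eta>0 powr (- \<alpha>) + \<alpha> * t) powr (- (1 / \<alpha>))))"

definition m_sol :: "real \<Rightarrow> (real \<Rightarrow> real) \<Rightarrow> real \<Rightarrow> real \<Rightarrow> real" where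
  "m_sol \<alpha> u0 t \<rho> =
     (if t = 0 then mass u0 \<rho>
      else (case char_inv \<alpha> u0 t \<rho> of (\<rho>0, \<eta>0) \<Rightarrow>
              mass u0 \<rho>0 * (1 + \<alpha> * \<eta>0 powr \<alpha> * t) powr (1 - 1 / \<alpha>)))"

definition tendsto_L1 ::
  "'a measure \<Rightarrow> ('b \<Rightarrow> 'a \<Rightarrow> real) \<Rightarrow> ('a \<Rightarrow> real) \<Rightarrow> 'b filter \<Rightarrow> bool" where
  "tendsto_L1 M f g F \<longleftrightarrow>
     integrable M g \<and> (\<forall>\<^sub>F t in F. integrable M (f t)) \<and>
     ((\<lambda>t. \<integral>x. \<bar>f t x - g x\<bar> \<partial>M) \<longlongrightarrow> 0) F"

text \<open>
  Classical solutions of the Cauchy problem for \<open>m\<^sub>t + m (m\<^sub>\<rho>)\<^sup>\<alpha> = 0\<close>: continuous up to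
  the initial time, and \<open>C\<^sup>1\<close> with the equation satisfied pointwise for \<open>t > 0\<close> and
  \<open>\<rho> \<ge> 0\<close> (one-sided \<open>\<rho>\<close>-derivative at \<open>\<rho> = 0\<close>). The condition
  \<open>m\<^sub>\<rho> \<ge> 0\<close> makes the real power meaningful.
\<close>

definition classical_solution :: "real \<Rightarrow> (real \<Rightarrow> real) \<Rightarrow> (real \<Rightarrow> real \<Rightarrow> real) \<Rightarrow> bool" where
  "classical_solution \<alpha> m0 m \<longleftrightarrow>
     continuous_on ({0..} \<times> {0..}) (\<lambda>(t, \<rho>). m t \<rho>) \<and>
     (\<forall>\<rho>\<ge>0. m 0 \<rho> = m0 \<rho>) \<and>
     (\<exists>m_t m_\<rho> :: real \<Rightarrow> real \<Rightarrow> real.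
        continuous_on ({0<..} \<times> {0..}) (\<lambda>(t, \<rho>). m_t t \<rho>) \<and>
        continuous_on ({0<..} \<times> {0..}) (\<lambda>(t, \<rho>). m_\<rho> t \<rho>) \<and>
        (\<forall>t>0. \<forall>\<rho>\<ge>0.
           ((\<lambda>s. m s \<rho>) has_real_derivative m_t t \<rho>) (at t) \<and>
           (m t has_real_derivative m_\<rho> t \<rho>) (at \<rho> within {0..}) \<and>
           0 \<le> m_\<rho> t \<rho> \<and>
           m_t t \<rho> + m t \<rho> * m_\<rho> t \<rho> powr \<alpha> = 0))"

end

(*
  The equation has the explicit solutions (eta^(-alpha) + alpha t)^(-1/alpha) (rho - c), affine in
  rho. Take those that start at t = 0 from the tangents of the concave function m0: the tangent at
  r of slope eta, for (r, eta) in char_dom u0. By the power mean inequality the function m defined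
  along characteristics is the minimum of this family, and it touches the member (r, eta) along the
  characteristic issued from (r, eta). Comparing m at two points with the two members that touch
  it there bounds every increment of m in rho and in t from both sides, and together with the
  continuity of u this yields both partial derivatives, although the initial datum may jump.

  The continuity of u comes from the monotonicity of P_t along the graph: a graph point whose
  characteristic passes to the left (right) of a point bounds eta from above (below) near that point.
*)
theory Submission
  imports Defs
begin

section \<open>Monotone densities and their mass\<close>

text \<open>Differentiating along characteristics would require a differentiable inverse of
  \<open>char_map\<close>, which a merely monotone \<open>u0\<close> does not provide: at a jump a
  whole fan of characteristics leaves one foot, and elsewhere \<open>u0\<close> need not be
  differentiable. So no derivative of \<open>char_inv\<close> is ever taken. The set
  \<open>char_dom u0\<close> is the graph of \<open>u0\<close> completed by vertical segments at the
  jumps. Along it the foot increases and the slope decreases, which reduces injectivity and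
  surjectivity to order arguments. The affine solutions come from the ansatz
  \<open>b(t) * (\<rho> - c)\<close>: the equation forces
  \<open>b' = - b powr (1 + \<alpha>)\<close> and keeps \<open>c\<close> constant in time. At
  \<open>t = 0\<close> the function \<open>u\<close> is continuous only where \<open>u0\<close> is,
  so the continuity of \<open>m\<close> up to the initial time rests on Lipschitz bounds instead.
  The L1 limit combines \<open>m t \<le> m0\<close>, which keeps the total mass from growing, with
  convergence at all but the countably many discontinuities of \<open>u0\<close>.\<close>

locale decreasing_density =
  fixes u0 :: "real \<Rightarrow> real"
  assumes set_integrable_u0: "set_integrable lborel {0..} u0"
    and u0_nonneg: "0 \<le> \<rho> \<Longrightarrow> 0 \<le> u0 \<rho>"
    and antimono_u0: "antimono_on {0..} u0"
    and u0_nonzero: "\<not> (AE \<rho> in lborel. 0 \<le> \<rho> \<longrightarrow> u0 \<rho> = 0)"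
begin

abbreviation "R \<equiv> right_lim u0"
abbreviation "L \<equiv> left_lim u0"
abbreviation "m0 \<equiv> mass u0"

section \<open>One-sided limits of the density\<close>

lemma u0_le: "0 \<le> x \<Longrightarrow> x \<le> y \<Longrightarrow> u0 y \<le> u0 x"
  using antimono_u0 by (auto simp: monotone_on_def)

lemma tendsto_right_lim:
  assumes "0 \<le> r"
  shows "(u0 \<longlongrightarrow> R r) (at_right r)"
proof -
  have "((\<lambda>x. - u0 x) \<longlongrightarrow> Inf ((\<lambda>x. - u0 x) ` ({r<..} \<inter> {0..}))) (at r within ({r<..} \<inter> {0..}))"
    by (rule Lim_right_bound[where K = "- u0 r"]) (use assms u0_le in auto)
  moreover have "{r<..} \<inter> {0..} = {r<..}"
    using assms by auto
  ultimately obtain l where "((\<lambda>x. - u0 x) \<longlongrightarrow> l) (at_right r)"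
    by auto
  from tendsto_minus[OF this] have "(u0 \<longlongrightarrow> - l) (at_right r)"
    by simp
  then show ?thesis
    unfolding right_lim_def using tendsto_Lim[OF trivial_limit_at_right_real] by fastforce
qed

lemma tendsto_left_lim:
  assumes "0 < r"
  shows "(u0 \<longlongrightarrow> L r) (at_left r)"
proof -
  have "((\<lambda>x. - u0 x) \<longlongrightarrow> Sup ((\<lambda>x. - u0 x) ` ({..<r} \<inter> {0..}))) (at r within ({..<r} \<inter> {0..}))"
    by (rule Lim_left_bound[where K = "- u0 r"]) (use assms u0_le in auto)
  moreover have "at r within ({..<r} \<inter> {0..}) = at_left r"
    by (rule at_within_nhd[of r "{0<..}"]) (use assms in auto)
  ultimately obtain l where "((\<lambda>x. - u0 x) \<longlongrightarrow> l) (at_left r)"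
    by auto
  from tendsto_minus[OF this] have "(u0 \<longlongrightarrow> - l) (at_left r)"
    by simp
  then show ?thesis
    unfolding left_lim_def using assms tendsto_Lim[OF trivial_limit_at_left_real] by fastforce
qed

lemma left_lim_0: "L 0 = R 0"
  by (simp add: left_lim_def right_lim_def)

lemma u0_le_right_lim:
  assumes "0 \<le> r" "r < x"
  shows "u0 x \<le> R r"
proof (rule tendsto_lowerbound[OF tendsto_right_lim[OF assms(1)]])
  show "\<forall>\<^sub>F y in at_right r. u0 x \<le> u0 y"
    using eventually_at_right_real[OF assms(2)]
    by eventually_elim (use assms u0_le in auto)
qed simp

lemma right_lim_le_u0:
  assumes "0 \<le> r"
  shows "R r \<le> u0 r"
proof (rule tendsto_upperbound[OF tendsto_right_lim[OF assms(1)]])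
  show "\<forall>\<^sub>F y in at_right r. u0 y \<le> u0 r"
    using eventually_at_right_less[of r] by eventually_elim (use assms u0_le in auto)
qed simp

lemma left_lim_le_u0:
  assumes "0 \<le> x" "x < r"
  shows "L r \<le> u0 x"
proof (rule tendsto_upperbound[OF tendsto_left_lim])
  show "\<forall>\<^sub>F y in at_left r. u0 y \<le> u0 x"
    using eventually_at_left_real[OF assms(2)]
    by eventually_elim (use assms u0_le in auto)
qed (use assms in auto)

lemma u0_le_left_lim:
  assumes "0 < r"
  shows "u0 r \<le> L r"
proof (rule tendsto_lowerbound[OF tendsto_left_lim[OF assms(1)]])
  show "\<forall>\<^sub>F y in at_left r. u0 r \<le> u0 y"
    using eventually_at_left_real[OF assms] by eventually_elim (use assms u0_le in auto)
qed simp

lemma right_lim_le_left_lim: "0 \<le> r \<Longrightarrow> R r \<le> L r"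
  using right_lim_le_u0[of r] u0_le_left_lim[of r] left_lim_0 by (cases "r = 0") auto

lemma left_lim_le_right_lim:
  assumes "0 \<le> r" "r < s"
  shows "L s \<le> R r"
  using left_lim_le_u0[of "(r + s) / 2" s] u0_le_right_lim[of r "(r + s) / 2"] assms by auto

lemma left_lim_le_max: "0 \<le> r \<Longrightarrow> L r \<le> R 0"
  using left_lim_le_right_lim[of 0 r] left_lim_0 by (cases "r = 0") auto

lemma right_lim_nonneg: "0 \<le> r \<Longrightarrow> 0 \<le> R r"
  using u0_le_right_lim[of r "r + 1"] u0_nonneg[of "r + 1"] by auto

text \<open>Nontriviality enters here. It puts \<open>(0, R 0)\<close> in \<open>char_dom u0\<close>
  and makes the mass positive away from 0.\<close>

lemma right_lim_0_pos: "0 < R 0"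
proof (rule ccontr)
  assume "\<not> 0 < R 0"
  then have "u0 x = 0" if "0 < x" for x
    using u0_le_right_lim[of 0 x] u0_nonneg[of x] that by auto
  then have "AE \<rho> in lborel. 0 \<le> \<rho> \<longrightarrow> u0 \<rho> = 0"
    by (intro eventually_mono[OF AE_lborel_singleton[of 0]]) auto
  with u0_nonzero show False ..
qed

text \<open>The approximating value is taken by \<open>L\<close> and not by \<open>u0\<close>,
  because \<open>(y, L y)\<close> can serve as a graph point while \<open>(y, u0 y)\<close> need not
  be at hand. Going halfway from \<open>z\<close> to \<open>r\<close> turns a bound on
  \<open>u0 z\<close> into one on \<open>L\<close>.\<close>

lemma left_lim_approx:
  assumes "0 \<le> x" "x < r" "L r < c"
  obtains y where "x < y" "y < r" "L y < c"
proof -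
  have "\<forall>\<^sub>F z in at_left r. u0 z < c \<and> z \<in> {x<..<r}"
    using order_tendstoD(2)[OF tendsto_left_lim assms(3)] eventually_at_left_real[OF assms(2)] assms
    by (auto intro: eventually_conj)
  then obtain z where z: "u0 z < c" "z \<in> {x<..<r}"
    using eventually_happens'[OF trivial_limit_at_left_real] by blast
  show ?thesis
    using that[of "(z + r) / 2"] left_lim_le_u0[of z "(z + r) / 2"] z assms by auto
qed

lemma right_lim_approx:
  assumes "0 \<le> r" "r < x" "c < R r"
  obtains y where "r < y" "y < x" "c < R y"
proof -
  have "\<forall>\<^sub>F z in at_right r. c < u0 z \<and> z \<in> {r<..<x}"
    using order_tendstoD(1)[OF tendsto_right_lim assms(3)] eventually_at_right_real[OF assms(2)] assms
    by (auto intro: eventually_conj)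
  then obtain z where z: "c < u0 z" "z \<in> {r<..<x}"
    using eventually_happens'[OF trivial_limit_at_right_real] by blast
  show ?thesis
    using that[of "(r + z) / 2"] u0_le_right_lim[of "(r + z) / 2" z] z assms by auto
qed

section \<open>The mass and its increments\<close>

lemma u0_integrable_on: "0 \<le> a \<Longrightarrow> u0 integrable_on {a..b}"
proof -
  assume "0 \<le> a"
  then have "set_integrable lborel {a..b} u0"
    by (intro set_integrable_subset[OF set_integrable_u0]) auto
  then show ?thesis
    by (rule set_borel_integral_eq_integral)
qed

lemma mass_eq_integral: "m0 \<rho> = integral {0..\<rho>} u0"
  unfolding mass_def
  by (rule set_borel_integral_eq_integral, rule set_integrable_subset[OF set_integrable_u0]) auto

lemma mass_diff:
  assumes "0 \<le> a" "a \<le> b"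
  shows "m0 b - m0 a = integral {a..b} u0"
  using Henstock_Kurzweil_Integration.integral_combine[OF assms u0_integrable_on] 
  by (simp add: mass_eq_integral)

lemma mass_0: "m0 0 = 0"
  by (simp add: mass_eq_integral)

text \<open>The bound is required only inside the interval, so that one-sided limits at the
  endpoints can serve as \<open>c\<close> whatever value \<open>u0\<close> takes there.\<close>

lemma mass_diff_le:
  assumes "0 \<le> a" "a \<le> b" "\<And>x. a < x \<Longrightarrow> x < b \<Longrightarrow> u0 x \<le> c"
  shows "m0 b - m0 a \<le> c * (b - a)"
proof -
  have "integral {a<..<b} u0 \<le> integral {a<..<b} (\<lambda>x. c)"
    using assms u0_integrable_on[of a b]
    by (intro integral_le) (auto simp: integrable_on_Icc_iff_Ioo[symmetric])
  then show ?thesis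
    using assms by (simp add: mass_diff integral_open_interval_real[symmetric] mult.commute)
qed

lemma mass_diff_ge:
  assumes "0 \<le> a" "a \<le> b" "\<And>x. a < x \<Longrightarrow> x < b \<Longrightarrow> c \<le> u0 x"
  shows "c * (b - a) \<le> m0 b - m0 a"
proof -
  have "integral {a<..<b} (\<lambda>x. c) \<le> integral {a<..<b} u0"
    using assms u0_integrable_on[of a b]
    by (intro integral_le) (auto simp: integrable_on_Icc_iff_Ioo[symmetric])
  then show ?thesis
    using assms by (simp add: mass_diff integral_open_interval_real[symmetric] mult.commute)
qed

lemma mass_mono: "0 \<le> a \<Longrightarrow> a \<le> b \<Longrightarrow> m0 a \<le> m0 b"
  using mass_diff_ge[of a b 0] u0_nonneg by auto

lemma mass_nonneg: "0 \<le> a \<Longrightarrow> 0 \<le> m0 a"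
  using mass_mono[of 0 a] mass_0 by auto

lemma mass_lipschitz: "0 \<le> a \<Longrightarrow> 0 \<le> b \<Longrightarrow> \<bar>m0 a - m0 b\<bar> \<le> R 0 * \<bar>a - b\<bar>"
proof (induction a b rule: linorder_wlog)
  case (le a b)
  then show ?case
    using mass_diff_le[of a b "R 0"] mass_mono[of a b] u0_le_right_lim[of 0] by auto
next
  case (sym a b)
  then show ?case
    by (simp add: abs_minus_commute)
qed

lemma mass_le_total: "m0 \<rho> \<le> (LBINT x:{0..}. u0 x)"
  unfolding mass_def set_lebesgue_integral_def
proof (rule integral_mono)
  show "integrable lborel (\<lambda>x. indicator {0..\<rho>} x *\<^sub>R u0 x)"
    using set_integrable_subset[OF set_integrable_u0, of "{0..\<rho>}"] by (auto simp: set_integrable_def)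
  show "integrable lborel (\<lambda>x. indicator {0..} x *\<^sub>R u0 x)"
    using set_integrable_u0 by (simp add: set_integrable_def)
qed (auto simp: indicator_def u0_nonneg)

lemma mass_pos:
  assumes "0 < r"
  shows "0 < m0 r"
proof -
  obtain y where y: "0 < y" "y < r" "0 < R y"
    using right_lim_approx[OF order.refl assms right_lim_0_pos] by auto
  have "R y * (y - 0) \<le> m0 y - m0 0"
    using y left_lim_le_u0[of _ y] right_lim_le_left_lim[of y]
    by (intro mass_diff_ge) (auto intro: order.trans)
  then show ?thesis
    using y mass_mono[of y r] mass_0 by (smt (verit) mult_pos_pos)
qed

section \<open>The completed graph of the density\<close>

lemma char_dom_iff:
  "(r, \<eta>) \<in> char_dom u0 \<longleftrightarrow> 0 \<le> r \<and> 0 < \<eta> \<and> R r \<le> \<eta> \<and> \<eta> \<le> L r"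
  unfolding char_dom_def using right_lim_nonneg[of r] by auto

lemma char_dom_left: "0 \<le> r \<Longrightarrow> 0 < L r \<Longrightarrow> (r, L r) \<in> char_dom u0"
  using right_lim_le_left_lim by (simp add: char_dom_iff)

lemma char_dom_right: "0 \<le> r \<Longrightarrow> 0 < R r \<Longrightarrow> (r, R r) \<in> char_dom u0"
  using right_lim_le_left_lim by (simp add: char_dom_iff)

lemma char_dom_antimono: "(r, \<eta>) \<in> char_dom u0 \<Longrightarrow> (s, \<theta>) \<in> char_dom u0 \<Longrightarrow> r < s \<Longrightarrow> \<theta> \<le> \<eta>"
  using left_lim_le_right_lim[of r s] by (auto simp: char_dom_iff)

lemma char_dom_le_max: "(r, \<eta>) \<in> char_dom u0 \<Longrightarrow> \<eta> \<le> R 0"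
  using left_lim_le_max[of r] by (auto simp: char_dom_iff)

text \<open>The convention for \<open>left_lim\<close> at 0 makes the fibre over 0 a single point.
  Injectivity of \<open>char_map\<close> depends on this: since \<open>m0 0 = 0\<close>, every slope
  over the foot 0 would have image 0.\<close>

lemma char_dom_0: "(0, \<eta>) \<in> char_dom u0 \<longleftrightarrow> \<eta> = R 0"
  using right_lim_0_pos by (auto simp: char_dom_iff left_lim_0)

text \<open>The numbers \<open>\<eta>\<close> with \<open>(r, \<eta>)\<close> in \<open>char_dom u0\<close> are the supergradients of the concave function
  \<open>m0\<close> at \<open>r\<close>.\<close>

lemma mass_le_tangent:
  assumes "(r, \<eta>) \<in> char_dom u0" "0 \<le> s"
  shows "m0 s \<le> m0 r + \<eta> * (s - r)"
proof (cases "r \<le> s")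
  case True
  then show ?thesis
    using mass_diff_le[of r s \<eta>] u0_le_right_lim[of r] assms by (fastforce simp: char_dom_iff)
next
  case False
  have "\<eta> \<le> u0 x" if "s < x" "x < r" for x
    using left_lim_le_u0[of x r] that assms by (auto simp: char_dom_iff)
  with False show ?thesis
    using mass_diff_ge[of s r \<eta>] assms by (simp add: algebra_simps)
qed

end

section \<open>The characteristic map\<close>

text \<open>The mean of order \<alpha> of \<open>z\<close> and 1, with weights 1 and \<tau>, is at
  most their arithmetic mean; this form is obtained by taking the power \<open>1 / \<alpha>\<close>
  and rearranging.\<close>

lemma power_mean_bound:
  fixes \<alpha> z \<tau> :: real
  assumes "0 < \<alpha>" "\<alpha> < 1" "0 < z" "0 \<le> \<tau>"
  shows "(1 + \<tau>) powr (1 - 1 / \<alpha>) \<le> (z powr \<alpha> + \<tau>) powr (- (1 / \<alpha>)) * (z + \<tau>)"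
proof -
  \<comment> \<open>\<open>Z\<close> is the weighted arithmetic mean of \<open>z\<close> and
    1.\<close>
  define Z where "Z = (z + \<tau>) / (1 + \<tau>)"
  have Z: "0 < Z" "(1 + \<tau>) * Z = z + \<tau>"
    using assms by (auto simp: Z_def)
  \<comment> \<open>The tangent at 1 to the concave power, evaluated at \<open>x / Z\<close>.
    Summing over \<open>x = z\<close> with weight 1 and \<open>x = 1\<close> with weight \<tau>
    gives exactly \<open>1 + \<tau>\<close>, because \<open>Z\<close> is the mean.\<close>
  have young: "x powr \<alpha> / Z powr \<alpha> \<le> \<alpha> * (x / Z) + (1 - \<alpha>)" if "0 < x" for x
    using Youngs_inequality_0[of \<alpha> "1 - \<alpha>" "x / Z" 1] assms Z that by (simp add: powr_divide)
  have "(z powr \<alpha> + \<tau>) / Z powr \<alpha> = z powr \<alpha> / Z powr \<alpha> + \<tau> * (1 powr \<alpha> / Z powr \<alpha>)"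
    by (simp add: add_divide_distrib)
  also have "\<dots> \<le> (\<alpha> * (z / Z) + (1 - \<alpha>)) + \<tau> * (\<alpha> * (1 / Z) + (1 - \<alpha>))"
    using assms by (intro add_mono mult_left_mono young) auto
  also have "\<dots> = \<alpha> * ((z + \<tau>) / Z) + (1 - \<alpha>) * (1 + \<tau>)"
    using Z by (simp add: field_simps)
  also have "(z + \<tau>) / Z = 1 + \<tau>"
    using Z by (simp add: field_simps)
  finally have "(z powr \<alpha> + \<tau>) / Z powr \<alpha> \<le> 1 + \<tau>"
    by (simp add: algebra_simps)
  then have "z powr \<alpha> + \<tau> \<le> (1 + \<tau>) * Z powr \<alpha>"
    using Z by (simp add: divide_le_eq)
  then have "(z powr \<alpha> + \<tau>) powr (1 / \<alpha>) \<le> ((1 + \<tau>) * Z powr \<alpha>) powr (1 / \<alpha>)"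
    using assms by (intro powr_mono2) auto
  also have "\<dots> = (1 + \<tau>) powr (1 / \<alpha>) * Z"
    using assms Z by (simp add: powr_mult powr_powr)
  also have "\<dots> = (1 + \<tau>) powr (1 / \<alpha> - 1) * (z + \<tau>)"
    using assms by (simp add: powr_diff Z_def)
  finally have *: "(z powr \<alpha> + \<tau>) powr (1 / \<alpha>) \<le> (1 + \<tau>) powr (1 / \<alpha> - 1) * (z + \<tau>)" .
  have "0 < (z powr \<alpha> + \<tau>) powr (1 / \<alpha>)" "0 < (1 + \<tau>) powr (1 / \<alpha> - 1)"
    using assms by (auto simp: add_pos_nonneg add_pos_nonneg[THEN less_imp_neq, symmetric])
  with * have "inverse ((1 + \<tau>) powr (1 / \<alpha> - 1)) \<le> inverse ((z powr \<alpha> + \<tau>) powr (1 / \<alpha>)) * (z + \<tau>)"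
    by (simp add: divide_simps mult.commute)
  then show ?thesis
    by (simp flip: powr_minus)
qed

text \<open>The tangent at 1 to the convex power \<open>1 / \<alpha>\<close>. It later linearises
  the decay in time of the affine solutions.\<close>

lemma bernoulli_powr:
  fixes \<alpha> y :: real
  assumes "0 < \<alpha>" "\<alpha> < 1" "0 < y"
  shows "1 + (y - 1) / \<alpha> \<le> y powr (1 / \<alpha>)"
  using Youngs_inequality_0[of \<alpha> "1 - \<alpha>" "y powr (1 / \<alpha>)" 1] assms
  by (simp add: powr_powr field_simps)

text \<open>The solution of \<open>b' = - b powr (1 + \<alpha>)\<close> with \<open>b 0 = \<eta>\<close>: the slope transported along a
  characteristic.\<close>

definition slope :: "real \<Rightarrow> real \<Rightarrow> real \<Rightarrow> real" where
  "slope \<alpha> t \<eta> = (\<eta> powr (- \<alpha>) + \<alpha> * t) powr (- (1 / \<alpha>))"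

locale characteristics = decreasing_density +
  fixes \<alpha> :: real
  assumes \<alpha>_pos: "0 < \<alpha>" and \<alpha>_less: "\<alpha> < 1"
begin

abbreviation "G \<equiv> char_dom u0"
abbreviation "P \<equiv> char_map \<alpha> u0"
abbreviation "b \<equiv> slope \<alpha>"
abbreviation "u \<equiv> u_sol \<alpha> u0"
abbreviation "m \<equiv> m_sol \<alpha> u0"

section \<open>Order of the characteristics and injectivity\<close>

lemma char_map_eq: "P t (r, \<eta>) = r + \<alpha> * m0 r * \<eta> powr (\<alpha> - 1) * t"
  by (simp add: char_map_def)

text \<open>Moving right along the graph, or down within a vertical segment, the mass does not
  decrease and the slope does not increase. As \<open>\<alpha> - 1 < 0\<close>, the speed
  \<open>\<alpha> * m0 r * \<eta> powr (\<alpha> - 1)\<close> does not decrease either. Within one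
  fibre strictness comes from \<open>m0 r > 0\<close>; over the foot 0 there is only one
  point.\<close>

lemma char_map_strict:
  assumes t: "0 < t" and G: "(r, \<eta>) \<in> G" "(s, \<theta>) \<in> G" and less: "r < s \<or> r = s \<and> \<theta> < \<eta>"
  shows "P t (r, \<eta>) < P t (s, \<theta>)"
  using less
proof
  assume "r < s"
  then have "\<theta> \<le> \<eta>"
    using char_dom_antimono G by blast
  then have "\<eta> powr (\<alpha> - 1) \<le> \<theta> powr (\<alpha> - 1)"
    using G \<alpha>_less by (intro powr_mono2') (auto simp: char_dom_iff)
  then have "\<alpha> * m0 r * \<eta> powr (\<alpha> - 1) * t \<le> \<alpha> * m0 s * \<theta> powr (\<alpha> - 1) * t"
    using t G \<open>r < s\<close> \<alpha>_pos
    by (intro mult_right_mono mult_mono mass_mono) (auto simp: char_dom_iff mass_nonneg)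
  with \<open>r < s\<close> show ?thesis
    by (simp add: char_map_eq)
next
  assume *: "r = s \<and> \<theta> < \<eta>"
  then have "r \<noteq> 0"
    using G char_dom_0 by auto
  then have "0 < m0 r"
    using G by (intro mass_pos) (simp add: char_dom_iff)
  moreover have "\<eta> powr (\<alpha> - 1) < \<theta> powr (\<alpha> - 1)"
    using * G \<alpha>_less by (intro powr_less_mono2_neg) (auto simp: char_dom_iff)
  ultimately show ?thesis
    using * t \<alpha>_pos by (simp add: char_map_eq)
qed

lemma char_map_less_imp:
  assumes t: "0 < t" and G: "(r, \<eta>) \<in> G" "(s, \<theta>) \<in> G" and less: "P t (r, \<eta>) < P t (s, \<theta>)"
  shows "r \<le> s \<and> \<theta> \<le> \<eta>"
proof (rule ccontr)
  assume *: "\<not> (r \<le> s \<and> \<theta> \<le> \<eta>)"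
  show False
  proof (cases r s rule: linorder_cases)
    case less
    then show ?thesis
      using * char_dom_antimono G by auto
  next
    case equal
    then show ?thesis
      using * char_map_strict[OF t G(2,1)] \<open>P t (r, \<eta>) < P t (s, \<theta>)\<close> by auto
  next
    case greater
    then show ?thesis
      using char_map_strict[OF t G(2,1)] \<open>P t (r, \<eta>) < P t (s, \<theta>)\<close> by auto
  qed
qed

lemma char_map_inj:
  assumes "0 < t"
  shows "inj_on (P t) G"
proof (rule inj_onI, clarify)
  fix r \<eta> s \<theta>
  assume *: "(r, \<eta>) \<in> G" "(s, \<theta>) \<in> G" "P t (r, \<eta>) = P t (s, \<theta>)"
  show "r = s \<and> \<eta> = \<theta>"
    using char_map_strict[OF assms *(1,2)] char_map_strict[OF assms *(2,1)] *(3)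
    by (metis less_irrefl linorder_neqE)
qed

lemma char_map_ge:
  assumes "0 \<le> t" "(r, \<eta>) \<in> G"
  shows "r \<le> P t (r, \<eta>)"
  using assms \<alpha>_pos mass_nonneg[of r] by (simp add: char_map_eq char_dom_iff)

section \<open>Surjectivity\<close>

lemma tendsto_mass:
  assumes "0 < s \<and> F = at_left s \<or> 0 \<le> s \<and> F = at_right s"
  shows "(m0 \<longlongrightarrow> m0 s) F"
proof (rule LIM_zero_cancel, rule Lim_null_comparison)
  have "\<forall>\<^sub>F y in F. 0 \<le> y"
    using assms eventually_at_right_less[of s] eventually_at_left_real[of 0 s]
    by (auto elim!: eventually_mono)
  then show "\<forall>\<^sub>F y in F. norm (m0 y - m0 s) \<le> R 0 * \<bar>y - s\<bar>"
    by eventually_elim (use assms mass_lipschitz in auto)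
  have "((\<lambda>y. R 0 * \<bar>y - s\<bar>) \<longlongrightarrow> R 0 * \<bar>s - s\<bar>) (at s within S)" for S
    by (intro tendsto_intros)
  then show "((\<lambda>y. R 0 * \<bar>y - s\<bar>) \<longlongrightarrow> 0) F"
    using assms by auto
qed

lemma left_lim_left_continuous:
  assumes "0 < s"
  shows "(L \<longlongrightarrow> L s) (at_left s)"
proof (rule order_tendstoI)
  fix c assume "c < L s"
  moreover have "L s \<le> L y" if "0 < y" "y < s" for y
    using that left_lim_le_right_lim[of y s] right_lim_le_left_lim[of y] by auto
  ultimately show "\<forall>\<^sub>F y in at_left s. c < L y"
    using eventually_at_left_real[OF assms] by (force elim!: eventually_mono)
next
  fix c assume "L s < c"
  then obtain y where y: "0 < y" "y < s" "L y < c"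
    using left_lim_approx[OF order.refl assms] by blast
  show "\<forall>\<^sub>F y in at_left s. L y < c"
    using eventually_at_left_real[OF y(2)]
  proof eventually_elim
    case (elim z)
    then show ?case
      using y left_lim_le_right_lim[of y z] right_lim_le_left_lim[of y] by auto
  qed
qed

lemma right_lim_right_continuous:
  assumes "0 \<le> s"
  shows "(R \<longlongrightarrow> R s) (at_right s)"
proof (rule order_tendstoI)
  fix c assume "R s < c"
  moreover have "R y \<le> R s" if "s < y" for y
    using that assms left_lim_le_right_lim[of s y] right_lim_le_left_lim[of y] by auto
  ultimately show "\<forall>\<^sub>F y in at_right s. R y < c"
    using eventually_at_right_less[of s] by (force elim!: eventually_mono)
next
  fix c assume "c < R s"
  then obtain y where y: "s < y" "c < R y"
    using right_lim_approx[OF assms, of "s + 1"] by auto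
  show "\<forall>\<^sub>F y in at_right s. c < R y"
    using eventually_at_right_real[OF y(1)]
  proof eventually_elim
    case (elim z)
    then show ?case
      using y assms left_lim_le_right_lim[of z y] right_lim_le_left_lim[of y] by auto
  qed
qed

text \<open>An intermediate value argument on the completed graph. One-sided limits at the critical
  foot \<open>s\<close> place \<rho> between the images of \<open>(s, L s)\<close> and
  \<open>(s, R s)\<close>, and on that fibre the equation for \<eta> is solved explicitly.\<close>

lemma char_map_surj:
  assumes t: "0 < t" and "0 \<le> \<rho>"
  obtains p where "p \<in> G" "P t p = \<rho>"
proof -
  \<comment> \<open>On a fibre the slope \<open>L r\<close> gives the leftmost image, so
    \<open>A\<close> collects the feet from which some characteristic lands at or to the left of
    \<rho>.\<close>
  define A where "A = {r. 0 \<le> r \<and> 0 < L r \<and> P t (r, L r) \<le> \<rho>}"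
  define s where "s = Sup A"
  have "0 \<in> A"
    using right_lim_0_pos \<open>0 \<le> \<rho>\<close> by (simp add: A_def left_lim_0 char_map_eq mass_0)
  have A_le: "r \<le> \<rho>" if "r \<in> A" for r
    using that char_map_ge[of t r "L r"] char_dom_left[of r] t by (auto simp: A_def)
  then have bdd: "bdd_above A"
    by (auto simp: bdd_above_def)
  have "0 \<le> s"
    using cSup_upper[OF \<open>0 \<in> A\<close> bdd] by (simp add: s_def)
  have below: "y \<in> A" if y: "0 \<le> y" "y < s" for y
  proof -
    obtain r where r: "r \<in> A" "y < r"
      using less_cSupE[of y A] y \<open>0 \<in> A\<close> unfolding s_def by auto
    then have "L r \<le> L y"
      using left_lim_le_right_lim[of y r] right_lim_le_left_lim[of y] y by auto
    then have "0 < L y"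
      using r by (auto simp: A_def)
    then have "P t (y, L y) < P t (r, L r)"
      using y r by (intro char_map_strict[OF t] char_dom_left) (auto simp: A_def)
    with \<open>0 < L y\<close> y r show ?thesis
      by (auto simp: A_def)
  qed
  have above: "0 < R y \<Longrightarrow> \<rho> \<le> P t (y, R y)" if y: "s < y" for y
  proof -
    assume "0 < R y"
    then have G: "(y, L y) \<in> G" "(y, R y) \<in> G"
      using y \<open>0 \<le> s\<close> right_lim_le_left_lim[of y] by (auto intro: char_dom_left char_dom_right)
    have "y \<notin> A"
      using cSup_upper[OF _ bdd, of y] y by (auto simp: s_def)
    then have "\<rho> \<le> P t (y, L y)"
      using G y \<open>0 \<le> s\<close> by (auto simp: A_def char_dom_iff)
    also have "\<dots> \<le> P t (y, R y)"
      using char_map_strict[OF t G] right_lim_le_left_lim[of y] y \<open>0 \<le> s\<close>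
      by (cases "R y = L y") auto
    finally show ?thesis .
  qed
  have "0 < L s \<and> P t (s, L s) \<le> \<rho>"
  proof (cases "s = 0")
    case True
    with \<open>0 \<in> A\<close> show ?thesis
      by (auto simp: A_def)
  next
    case False
    then have "0 < s"
      using \<open>0 \<le> s\<close> by auto
    have "0 < L s"
    proof (rule ccontr)
      assume "\<not> 0 < L s"
      \<comment> \<open>If \<open>L s\<close> vanished, speeds would blow up near \<open>s\<close>.
        Taking the mass at \<open>s / 2\<close> makes \<open>k\<close> a lower bound for
        \<open>\<alpha> * m0 y * t\<close> for all \<open>y > s / 2\<close>, and \<open>c\<close>
        solves \<open>k * c powr (\<alpha> - 1) = \<rho> + 1\<close>, so slopes below
        \<open>c\<close> overshoot \<rho>.\<close>
      define k where "k = \<alpha> * m0 (s / 2) * t"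
      have "0 < k"
        using \<alpha>_pos t mass_pos[of "s / 2"] \<open>0 < s\<close> by (simp add: k_def)
      define c where "c = ((\<rho> + 1) / k) powr (1 / (\<alpha> - 1))"
      have "0 < c"
        using \<open>0 < k\<close> \<open>0 \<le> \<rho>\<close> by (simp add: c_def)
      have c: "k * c powr (\<alpha> - 1) = \<rho> + 1"
        using \<open>0 < k\<close> \<alpha>_less \<open>0 \<le> \<rho>\<close> by (simp add: c_def powr_powr)
      obtain y where y: "s / 2 < y" "y < s" "L y < c"
        using left_lim_approx[of "s / 2" s c] \<open>0 < s\<close> \<open>0 < c\<close> \<open>\<not> 0 < L s\<close> by auto
      have "y \<in> A"
        using below y \<open>0 < s\<close> by auto
      have "k * c powr (\<alpha> - 1) \<le> (\<alpha> * m0 y * t) * L y powr (\<alpha> - 1)"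
        unfolding k_def using y \<open>y \<in> A\<close> \<alpha>_pos \<alpha>_less t \<open>0 < s\<close>
        by (intro mult_mono mult_right_mono mult_left_mono mass_mono powr_mono2')
           (auto simp: A_def mass_nonneg)
      also have "\<dots> \<le> P t (y, L y)"
        using y \<open>0 < s\<close> by (simp add: char_map_eq mult_ac)
      also have "\<dots> \<le> \<rho>"
        using \<open>y \<in> A\<close> by (simp add: A_def)
      finally show False
        using c by simp
    qed
    moreover have "P t (s, L s) \<le> \<rho>"
    proof (rule tendsto_upperbound)
      show "((\<lambda>y. P t (y, L y)) \<longlongrightarrow> P t (s, L s)) (at_left s)"
        unfolding char_map_eq using \<open>0 < L s\<close> \<open>0 < s\<close>
        by (intro tendsto_intros tendsto_mass left_lim_left_continuous) auto
      show "\<forall>\<^sub>F y in at_left s. P t (y, L y) \<le> \<rho>"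
        using eventually_at_left_real[OF \<open>0 < s\<close>] by eventually_elim (use below A_def in auto)
    qed simp
    ultimately show ?thesis ..
  qed
  then have Ls: "0 < L s" "P t (s, L s) \<le> \<rho>"
    by auto
  \<comment> \<open>For \<open>R s = 0\<close> no such bound is needed: the fibre then contains
    arbitrarily small positive slopes, whose images are unbounded.\<close>
  have Rs: "\<rho> \<le> P t (s, R s)" if "0 < R s"
  proof (rule tendsto_lowerbound)
    show "((\<lambda>y. P t (y, R y)) \<longlongrightarrow> P t (s, R s)) (at_right s)"
      unfolding char_map_eq using that \<open>0 \<le> s\<close>
      by (intro tendsto_intros tendsto_mass right_lim_right_continuous) auto
    have "\<forall>\<^sub>F y in at_right s. 0 < R y"
      using order_tendstoD(1)[OF right_lim_right_continuous that] \<open>0 \<le> s\<close> by auto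
    then show "\<forall>\<^sub>F y in at_right s. \<rho> \<le> P t (y, R y)"
      using eventually_at_right_less[of s] by eventually_elim (use above in auto)
  qed simp
  show ?thesis
  proof (cases "s = 0")
    case True
    then have "\<rho> = 0"
      using Rs right_lim_0_pos \<open>0 \<le> \<rho>\<close> by (simp add: char_map_eq mass_0)
    then show ?thesis
      using that[of "(0, R 0)"] by (simp add: char_dom_0 char_map_eq mass_0)
  next
    case False
    then have "0 < s"
      using \<open>0 \<le> s\<close> by auto
    define k where "k = \<alpha> * m0 s * t"
    have "0 < k"
      using \<alpha>_pos t mass_pos[of s] \<open>0 < s\<close> by (simp add: k_def)
    have P: "P t (s, \<eta>) = s + k * \<eta> powr (\<alpha> - 1)" for \<eta>
      by (simp add: char_map_eq k_def mult_ac)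
    have "0 < k * L s powr (\<alpha> - 1)"
      using \<open>0 < k\<close> Ls by simp
    then have "s < \<rho>"
      using Ls P by simp
    \<comment> \<open>The solution of \<open>s + k * \<eta> powr (\<alpha> - 1) = \<rho>\<close>;
      what remains is to place it between \<open>R s\<close> and \<open>L s\<close>.\<close>
    define \<eta> where "\<eta> = ((\<rho> - s) / k) powr (1 / (\<alpha> - 1))"
    have "0 < \<eta>"
      using \<open>s < \<rho>\<close> \<open>0 < k\<close> by (simp add: \<eta>_def)
    have "P t (s, \<eta>) = \<rho>"
      using \<open>s < \<rho>\<close> \<open>0 < k\<close> \<alpha>_less by (simp add: P \<eta>_def powr_powr)
    moreover have "\<eta> \<le> L s"
    proof (rule ccontr)
      assume "\<not> \<eta> \<le> L s"
      then have "\<eta> powr (\<alpha> - 1) < L s powr (\<alpha> - 1)"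
        using Ls \<alpha>_less by (intro powr_less_mono2_neg) auto
      then show False
        using \<open>P t (s, \<eta>) = \<rho>\<close> Ls \<open>0 < k\<close> by (simp add: P flip: \<open>P t (s, \<eta>) = \<rho>\<close>)
    qed
    moreover have "R s \<le> \<eta>"
    proof (rule ccontr)
      assume "\<not> R s \<le> \<eta>"
      then have "R s powr (\<alpha> - 1) < \<eta> powr (\<alpha> - 1)"
        using \<open>0 < \<eta>\<close> \<alpha>_less by (intro powr_less_mono2_neg) auto
      moreover have "\<rho> \<le> P t (s, R s)"
        using Rs \<open>\<not> R s \<le> \<eta>\<close> \<open>0 < \<eta>\<close> by auto
      ultimately show False
        using \<open>0 < k\<close> by (simp add: P flip: \<open>P t (s, \<eta>) = \<rho>\<close>)
    qed
    ultimately show ?thesis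
      using that[of "(s, \<eta>)"] \<open>0 < \<eta>\<close> \<open>0 < s\<close> by (simp add: char_dom_iff)
  qed
qed

lemma char_map_bij:
  assumes "0 < t"
  shows "bij_betw (P t) G {0..}"
  unfolding bij_betw_def
proof
  show "P t ` G = {0..}"
  proof (intro equalityI subsetI)
    fix y assume "y \<in> P t ` G"
    then show "y \<in> {0..}"
      using char_map_ge[of t] assms by (fastforce simp: char_dom_iff)
  qed (metis atLeast_iff char_map_surj[OF assms] imageI)
qed (rule char_map_inj[OF assms])

lemma char_invE:
  assumes "0 < t" "0 \<le> \<rho>"
  obtains r \<eta> where "char_inv \<alpha> u0 t \<rho> = (r, \<eta>)" "(r, \<eta>) \<in> G" "P t (r, \<eta>) = \<rho>"
proof -
  obtain p where p: "p \<in> G" "P t p = \<rho>"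
    using char_map_surj[OF assms] .
  then have "char_inv \<alpha> u0 t \<rho> = p"
    unfolding char_inv_def using the_inv_into_f_f[OF char_map_inj[OF assms(1)], of p] by auto
  with p that show ?thesis
    by (cases p) auto
qed

lemma char_inv_char_map: "0 < t \<Longrightarrow> p \<in> G \<Longrightarrow> char_inv \<alpha> u0 t (P t p) = p"
  unfolding char_inv_def by (rule the_inv_into_f_f[OF char_map_inj])

end

section \<open>Continuity of the density\<close>

text \<open>The bounds concern increments, so one hypothesis serves both sides of \<open>x\<close>.
  Dividing by a negative \<open>y - x\<close> swaps them, which \<open>min\<close> and
  \<open>max\<close> absorb.\<close>

lemma has_real_derivative_sandwich:
  fixes f g k :: "real \<Rightarrow> real"
  assumes g: "(g \<longlongrightarrow> D) (at x within S)" and k: "(k \<longlongrightarrow> D) (at x within S)"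
    and ev: "\<forall>\<^sub>F y in at x within S. g y * (y - x) \<le> f y - f x \<and> f y - f x \<le> k y * (y - x)"
  shows "(f has_real_derivative D) (at x within S)"
  unfolding has_field_derivative_iff
proof (rule tendsto_sandwich)
  have ne: "\<forall>\<^sub>F y in at x within S. y \<noteq> x"
    by (simp add: eventually_at_filter)
  show "\<forall>\<^sub>F y in at x within S. min (g y) (k y) \<le> (f y - f x) / (y - x)"
    using ev ne
  proof eventually_elim
    case (elim y)
    then show ?case
      by (cases "x < y") (auto simp: min_le_iff_disj pos_le_divide_eq neg_le_divide_eq)
  qed
  show "\<forall>\<^sub>F y in at x within S. (f y - f x) / (y - x) \<le> max (g y) (k y)"
    using ev ne
  proof eventually_elim
    case (elim y)
    then show ?case
      by (cases "x < y") (auto simp: le_max_iff_disj pos_divide_le_eq neg_divide_le_eq)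
  qed
  show "((\<lambda>y. min (g y) (k y)) \<longlongrightarrow> D) (at x within S)"
    using tendsto_min[OF g k] by simp
  show "((\<lambda>y. max (g y) (k y)) \<longlongrightarrow> D) (at x within S)"
    using tendsto_max[OF g k] by simp
qed

context characteristics
begin

section \<open>The transported slope\<close>

lemma slope_pos: "0 < \<eta> \<Longrightarrow> 0 \<le> t \<Longrightarrow> 0 < b t \<eta>"
  using \<alpha>_pos by (simp add: slope_def add_pos_nonneg[THEN less_imp_neq, symmetric])

lemma slope_0: "0 \<le> \<eta> \<Longrightarrow> b 0 \<eta> = \<eta>"
  using \<alpha>_pos by (cases "\<eta> = 0") (simp_all add: slope_def powr_powr)

lemma slope_eq:
  assumes "0 < \<eta>" "0 \<le> t"
  shows "b t \<eta> = \<eta> * (1 + \<alpha> * \<eta> powr \<alpha> * t) powr (- (1 / \<alpha>))"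
proof -
  have "\<eta> powr (- \<alpha>) + \<alpha> * t = \<eta> powr (- \<alpha>) * (1 + \<alpha> * \<eta> powr \<alpha> * t)"
    using assms by (simp add: powr_minus field_simps)
  then show ?thesis
    using assms \<alpha>_pos by (simp add: slope_def powr_mult powr_powr)
qed

lemma slope_powr: "0 < \<eta> \<Longrightarrow> 0 \<le> t \<Longrightarrow> b t \<eta> powr \<alpha> = 1 / (\<eta> powr (- \<alpha>) + \<alpha> * t)"
  using \<alpha>_pos by (simp add: slope_def powr_powr powr_neg_one add_pos_nonneg)

lemma one_plus_powr_le_one:
  assumes "0 \<le> x" "0 \<le> t" "c \<le> 0"
  shows "(1 + \<alpha> * x powr \<alpha> * t) powr c \<le> 1"
proof -
  have "1 \<le> 1 + \<alpha> * x powr \<alpha> * t"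
    using assms \<alpha>_pos by simp
  then show ?thesis
    using powr_mono[of c 0 "1 + \<alpha> * x powr \<alpha> * t"] assms by simp
qed

lemma slope_le: "0 < \<eta> \<Longrightarrow> 0 \<le> t \<Longrightarrow> b t \<eta> \<le> \<eta>"
  using one_plus_powr_le_one[of \<eta> t "- (1 / \<alpha>)"] \<alpha>_pos
  by (simp add: slope_eq mult_left_le)

text \<open>The slope at the foot of the characteristic through \<open>(t, \<rho>)\<close>,
  completed by \<open>u0\<close> at the initial time. Unlike \<open>u\<close>, it can be compared
  directly with slopes of fixed graph points, and \<open>slope\<close> then carries its continuity
  over to \<open>u\<close>.\<close>

definition h :: "real \<Rightarrow> real \<Rightarrow> real" where
  "h t \<rho> = (if t = 0 then u0 \<rho> else snd (char_inv \<alpha> u0 t \<rho>))"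

lemma hE:
  assumes "0 < t" "0 \<le> \<rho>"
  obtains r where "char_inv \<alpha> u0 t \<rho> = (r, h t \<rho>)" "(r, h t \<rho>) \<in> G" "P t (r, h t \<rho>) = \<rho>"
  using char_invE[OF assms] assms by (metis h_def less_irrefl snd_conv)

lemma u_eq_slope:
  assumes "0 \<le> t" "0 \<le> \<rho>"
  shows "u t \<rho> = b t (h t \<rho>)"
proof (cases "t = 0")
  case True
  then show ?thesis
    using assms u0_nonneg by (simp add: u_sol_def h_def slope_0)
next
  case False
  then show ?thesis
    by (simp add: u_sol_def h_def slope_def case_prod_unfold)
qed

lemma h_pos: "0 < t \<Longrightarrow> 0 \<le> \<rho> \<Longrightarrow> 0 < h t \<rho>"
  by (rule hE) (auto simp: char_dom_iff)

lemma h_nonneg: "0 \<le> t \<Longrightarrow> 0 \<le> \<rho> \<Longrightarrow> 0 \<le> h t \<rho>"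
  using h_pos[of t \<rho>] u0_nonneg by (cases "t = 0") (auto simp: h_def)

lemma h_le_max: "0 < t \<Longrightarrow> 0 \<le> \<rho> \<Longrightarrow> h t \<rho> \<le> R 0"
  by (rule hE) (auto intro: char_dom_le_max)

lemma u_pos: "0 < t \<Longrightarrow> 0 \<le> \<rho> \<Longrightarrow> 0 < u t \<rho>"
  by (simp add: u_eq_slope h_pos slope_pos)

lemma u_le_h: "0 \<le> t \<Longrightarrow> 0 \<le> \<rho> \<Longrightarrow> u t \<rho> \<le> h t \<rho>"
  using h_pos[of t \<rho>] slope_le[of "h t \<rho>" t] u0_nonneg
  by (cases "t = 0") (auto simp: u_eq_slope slope_0 h_nonneg)

lemma u_nonneg: "0 \<le> t \<Longrightarrow> 0 \<le> \<rho> \<Longrightarrow> 0 \<le> u t \<rho>"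
  using u_pos[of t \<rho>] u0_nonneg by (cases "t = 0") (auto simp: u_sol_def)

lemma u_le_max: "0 < t \<Longrightarrow> 0 \<le> \<rho> \<Longrightarrow> u t \<rho> \<le> R 0"
  using u_le_h[of t \<rho>] h_le_max[of t \<rho>] by auto

text \<open>Characteristics do not cross, so one that passes to the left of \<rho> starts at a graph
  point with at least the slope \<open>h t \<rho>\<close>. At \<open>t = 0\<close> the feet
  themselves are compared, which lets one statement cover the initial time.\<close>

lemma h_le:
  assumes "0 \<le> t" "0 \<le> \<rho>" "(r, \<eta>) \<in> G" "P t (r, \<eta>) < \<rho>"
  shows "h t \<rho> \<le> \<eta>"
proof (cases "t = 0")
  case True
  then show ?thesis
    using u0_le_right_lim[of r \<rho>] assms by (auto simp: h_def char_map_eq char_dom_iff)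
next
  case False
  then obtain s where "(s, h t \<rho>) \<in> G" "P t (s, h t \<rho>) = \<rho>"
    using hE[of t \<rho>] assms by auto
  then show ?thesis
    using char_map_less_imp[of t r \<eta> s "h t \<rho>"] assms False by auto
qed

lemma h_ge:
  assumes "0 \<le> t" "0 \<le> \<rho>" "(r, \<eta>) \<in> G" "\<rho> < P t (r, \<eta>)"
  shows "\<eta> \<le> h t \<rho>"
proof (cases "t = 0")
  case True
  then show ?thesis
    using left_lim_le_u0[of \<rho> r] assms by (auto simp: h_def char_map_eq char_dom_iff)
next
  case False
  then obtain s where "(s, h t \<rho>) \<in> G" "P t (s, h t \<rho>) = \<rho>"
    using hE[of t \<rho>] assms by auto
  then show ?thesis
    using char_map_less_imp[of t s "h t \<rho>" r \<eta>] assms False by auto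
qed

section \<open>Joint continuity of the foot slope and of the density\<close>

lemma eventually_quadrant:
  fixes t \<rho> :: real
  shows "\<forall>\<^sub>F z in at (t, \<rho>) within {0..} \<times> {0..}. 0 \<le> fst z \<and> 0 \<le> snd z"
  by (simp add: eventually_at_filter mem_Times_iff)

lemma tendsto_char_map:
  "((\<lambda>z. P (fst z) (r, \<eta>) - snd z) \<longlongrightarrow> P t (r, \<eta>) - \<rho>) (at (t, \<rho>) within S)"
proof -
  have "((\<lambda>z. P (fst z) (r, \<eta>) - snd z) \<longlongrightarrow> P (fst (t, \<rho>)) (r, \<eta>) - snd (t, \<rho>)) (at (t, \<rho>) within S)"
    unfolding char_map_eq by (intro tendsto_intros)
  then show ?thesis
    by simp
qed

text \<open>For a fixed graph point \<open>P t (r, \<eta>) - \<rho>\<close> is continuous in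
  \<open>(t, \<rho>)\<close>, so its sign persists nearby and \<open>h_le\<close> applies
  there.\<close>

lemma eventually_h_less:
  assumes "(r, \<eta>) \<in> G" "P t (r, \<eta>) < \<rho>" "\<eta> < c"
  shows "\<forall>\<^sub>F z in at (t, \<rho>) within {0..} \<times> {0..}. h (fst z) (snd z) < c"
proof -
  have "\<forall>\<^sub>F z in at (t, \<rho>) within {0..} \<times> {0..}. P (fst z) (r, \<eta>) - snd z < 0"
    by (rule order_tendstoD(2)[OF tendsto_char_map]) (use assms in auto)
  then show ?thesis
    using eventually_quadrant
  proof eventually_elim
    case (elim z)
    then show ?case
      using h_le[of "fst z" "snd z" r \<eta>] assms by auto
  qed
qed

lemma eventually_h_greater:
  assumes "(r, \<eta>) \<in> G" "\<rho> < P t (r, \<eta>)" "c < \<eta>"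
  shows "\<forall>\<^sub>F z in at (t, \<rho>) within {0..} \<times> {0..}. c < h (fst z) (snd z)"
proof -
  have "\<forall>\<^sub>F z in at (t, \<rho>) within {0..} \<times> {0..}. 0 < P (fst z) (r, \<eta>) - snd z"
    by (rule order_tendstoD(1)[OF tendsto_char_map]) (use assms in auto)
  then show ?thesis
    using eventually_quadrant
  proof eventually_elim
    case (elim z)
    then show ?case
      using h_ge[of "fst z" "snd z" r \<eta>] assms by auto
  qed
qed

text \<open>The graph points that trap \<open>h\<close> lie on the same vertical segment as long as
  there is room on it; at an end of the segment they are taken over a nearby foot, to the left for
  an upper bound and to the right for a lower one.\<close>

lemma tendsto_h:
  assumes "0 < t" "0 \<le> \<rho>"
  shows "((\<lambda>z. h (fst z) (snd z)) \<longlongrightarrow> h t \<rho>) (at (t, \<rho>) within {0..} \<times> {0..})"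
proof -
  obtain r where G: "(r, h t \<rho>) \<in> G" and P: "P t (r, h t \<rho>) = \<rho>"
    using hE[OF assms] by metis
  then have r: "0 \<le> r" "0 < h t \<rho>" "R r \<le> h t \<rho>" "h t \<rho> \<le> L r"
    by (auto simp: char_dom_iff)
  show ?thesis
  proof (rule order_tendstoI)
    fix c assume c: "h t \<rho> < c"
    consider "h t \<rho> < L r" | "h t \<rho> = L r" "0 < r" | "r = 0"
      using r by fastforce
    then show "\<forall>\<^sub>F z in at (t, \<rho>) within {0..} \<times> {0..}. h (fst z) (snd z) < c"
    proof cases
      case 1
      define \<eta> where "\<eta> = (h t \<rho> + min c (L r)) / 2"
      have \<eta>: "h t \<rho> < \<eta>" "\<eta> < c" "(r, \<eta>) \<in> G"
        using 1 c r by (auto simp: \<eta>_def char_dom_iff min_def)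
      then show ?thesis
        using char_map_strict[OF assms(1) \<eta>(3) G] P by (intro eventually_h_less[of r \<eta>]) auto
    next
      case 2
      then obtain y where y: "0 < y" "y < r" "L y < c"
        using left_lim_approx[of 0 r c] c by auto
      then have "(y, L y) \<in> G"
        using left_lim_le_right_lim[of y r] right_lim_le_left_lim[of y] r by (intro char_dom_left) auto
      then show ?thesis
        using char_map_strict[OF assms(1) _ G] P y by (intro eventually_h_less[of y "L y"]) auto
    next
      case 3
      \<comment> \<open>No graph point lies to the left of the foot 0, but \<open>R 0\<close> bounds
        \<open>h\<close> everywhere at positive times. Time 0 has to be excluded because
        \<open>u0 0\<close> may exceed \<open>R 0\<close>.\<close>
      then have "h t \<rho> = R 0"
        using G char_dom_0 by auto
      have "\<forall>\<^sub>F z in at (t, \<rho>) within {0..} \<times> {0..}. 0 < fst z"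
        using order_tendstoD(1)[OF tendsto_fst[OF tendsto_ident_at], of 0 "(t, \<rho>)"] assms by auto
      then show ?thesis
        using eventually_quadrant
        by eventually_elim (use h_le_max c \<open>h t \<rho> = R 0\<close> in fastforce)
    qed
  next
    fix c assume c: "c < h t \<rho>"
    show "\<forall>\<^sub>F z in at (t, \<rho>) within {0..} \<times> {0..}. c < h (fst z) (snd z)"
    proof (cases "R r < h t \<rho>")
      case True
      define \<eta> where "\<eta> = (h t \<rho> + max c (R r)) / 2"
      have \<eta>: "\<eta> < h t \<rho>" "c < \<eta>" "(r, \<eta>) \<in> G"
        using True c r right_lim_nonneg[of r] by (auto simp: \<eta>_def char_dom_iff max_def)
      then show ?thesis
        using char_map_strict[OF assms(1) G \<eta>(3)] P by (intro eventually_h_greater[of r \<eta>]) auto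
    next
      case False
      \<comment> \<open>The maximum with 0 keeps \<open>R y\<close> positive, so that
        \<open>(y, R y)\<close> is a graph point.\<close>
      then obtain y where y: "r < y" "max c 0 < R y"
        using right_lim_approx[of r "r + 1" "max c 0"] c r by auto
      then have "(y, R y) \<in> G"
        using r by (intro char_dom_right) auto
      then show ?thesis
        using char_map_strict[OF assms(1) G] P y by (intro eventually_h_greater[of y "R y"]) auto
    qed
  qed
qed

lemma one_sided_limits_if_continuous:
  assumes "0 \<le> \<rho>" "continuous (at \<rho> within {0..}) u0"
  shows "R \<rho> = u0 \<rho>" and "0 < \<rho> \<Longrightarrow> L \<rho> = u0 \<rho>"
proof -
  have u0: "(u0 \<longlongrightarrow> u0 \<rho>) (at \<rho> within {0..})"
    using assms(2) by (simp add: continuous_within)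
  have "(u0 \<longlongrightarrow> u0 \<rho>) (at_right \<rho>)"
    by (rule tendsto_within_subset[OF u0]) (use assms in auto)
  then show "R \<rho> = u0 \<rho>"
    using tendsto_unique[OF _ tendsto_right_lim[OF assms(1)]] by auto
  assume "0 < \<rho>"
  then have "at_left \<rho> = at \<rho> within {0..<\<rho>}"
    by (intro at_within_nhd[of \<rho> "{0<..}"]) auto
  then have "(u0 \<longlongrightarrow> u0 \<rho>) (at_left \<rho>)"
    using tendsto_within_subset[OF u0, of "{0..<\<rho>}"] by (simp add: subset_iff)
  then show "L \<rho> = u0 \<rho>"
    using tendsto_unique[OF _ tendsto_left_lim[OF \<open>0 < \<rho>\<close>]] by auto
qed

text \<open>Where \<open>L z\<close> vanishes, \<open>(z, L z)\<close> is not a graph point and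
  small positive slopes must be found elsewhere. Surjectivity supplies them: no foot lies beyond
  \<open>z\<close>, so distant targets are reached only at high speed, that is, with small
  slope.\<close>

lemma char_dom_small:
  assumes "0 \<le> z" "L z \<le> 0" "0 < c"
  obtains r \<eta> where "(r, \<eta>) \<in> G" "r \<le> z" "\<eta> < c"
proof -
  define K where "K = (LBINT x:{0..}. u0 x)"
  have "0 \<le> K"
    using mass_le_total[of 0] by (simp add: K_def mass_0)
  \<comment> \<open>At time 1 a characteristic with foot at most \<open>z\<close> and slope at least
    \<open>c\<close> gets no farther than \<open>N - 1\<close>, since the mass never exceeds
    \<open>K\<close>.\<close>
  define N where "N = z + \<alpha> * K * c powr (\<alpha> - 1) + 1"
  have "0 \<le> N"
    using assms \<alpha>_pos \<open>0 \<le> K\<close> by (simp add: N_def)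
  then obtain r \<eta> where G: "(r, \<eta>) \<in> G" and P: "P 1 (r, \<eta>) = N"
    using char_invE[of 1 N] zero_less_one by metis
  have "r \<le> z"
    using G assms left_lim_le_right_lim[of z r] right_lim_le_left_lim[of z]
    by (intro leI notI) (auto simp: char_dom_iff)
  moreover have "\<eta> < c"
  proof (rule ccontr)
    assume "\<not> \<eta> < c"
    then have "\<eta> powr (\<alpha> - 1) \<le> c powr (\<alpha> - 1)"
      using assms \<alpha>_less by (intro powr_mono2') auto
    then have "\<alpha> * m0 r * \<eta> powr (\<alpha> - 1) \<le> \<alpha> * K * c powr (\<alpha> - 1)"
      using \<alpha>_pos mass_le_total[of r] \<open>0 \<le> K\<close> G
      by (intro mult_mono) (auto simp: K_def char_dom_iff mass_nonneg)
    then show False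
      using P \<open>r \<le> z\<close> by (simp add: char_map_eq N_def)
  qed
  ultimately show ?thesis
    using that G by auto
qed

lemma tendsto_h_initial:
  assumes "0 \<le> \<rho>" "continuous (at \<rho> within {0..}) u0"
  shows "((\<lambda>z. h (fst z) (snd z)) \<longlongrightarrow> h 0 \<rho>) (at (0, \<rho>) within {0..} \<times> {0..})"
proof (rule order_tendstoI)
  note lims = one_sided_limits_if_continuous[OF assms]
  have h0: "h 0 \<rho> = u0 \<rho>"
    by (simp add: h_def)
  fix c assume c: "h 0 \<rho> < c"
  show "\<forall>\<^sub>F z in at (0, \<rho>) within {0..} \<times> {0..}. h (fst z) (snd z) < c"
  proof (cases "\<rho> = 0")
    case True
    \<comment> \<open>There is no foot to the left of 0, but \<open>R 0 \<le> u0 0 < c\<close>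
      bounds \<open>h\<close> on the whole quadrant.\<close>
    have "h t x < c" if "0 \<le> t" "0 \<le> x" for t x
      using c True h_le_max[of t x] u0_le[of 0 x] right_lim_le_u0[of 0] that by (cases "t = 0") (auto simp: h_def)
    then show ?thesis
      by (intro eventually_mono[OF eventually_quadrant]) auto
  next
    case False
    then obtain z where z: "0 < z" "z < \<rho>" "L z < c"
      using left_lim_approx[of 0 \<rho> c] c lims assms h0 by auto
    have "0 < c"
      using c h0 u0_nonneg[OF assms(1)] by auto
    obtain r \<eta> where "(r, \<eta>) \<in> G" "r < \<rho>" "\<eta> < c"
    proof (cases "0 < L z")
      case True
      then show ?thesis
        using that[of z "L z"] z char_dom_left[of z] by auto
    next
      case False
      then obtain r \<eta> where "(r, \<eta>) \<in> G" "r \<le> z" "\<eta> < c"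
        using char_dom_small[of z c] z \<open>0 < c\<close> by (metis less_imp_le not_less)
      then show ?thesis
        using that[of r \<eta>] z by simp
    qed
    then show ?thesis
      by (intro eventually_h_less[of r \<eta>]) (auto simp: char_map_eq)
  qed
next
  note lims = one_sided_limits_if_continuous[OF assms]
  fix c assume c: "c < h 0 \<rho>"
  show "\<forall>\<^sub>F z in at (0, \<rho>) within {0..} \<times> {0..}. c < h (fst z) (snd z)"
  proof (cases "c < 0")
    case True
    have "c < h t x" if "0 \<le> t" "0 \<le> x" for t x
      using True h_nonneg[OF that] by auto
    then show ?thesis
      by (intro eventually_mono[OF eventually_quadrant]) auto
  next
    case False
    have "c < R \<rho>"
      using c lims by (simp add: h_def)
    then obtain z where z: "\<rho> < z" "c < R z"
      using right_lim_approx[of \<rho> "\<rho> + 1" c] assms(1) by (metis less_add_one)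
    then show ?thesis
      using False char_dom_right[of z] assms
      by (intro eventually_h_greater[of z "R z"]) (auto simp: char_map_eq)
  qed
qed

lemma continuous_u:
  assumes \<rho>: "0 \<le> \<rho>" and t: "0 < t \<or> t = 0 \<and> continuous (at \<rho> within {0..}) u0"
  shows "continuous (at (t, \<rho>) within {0..} \<times> {0..}) (\<lambda>(t, \<rho>). u t \<rho>)"
proof -
  let ?F = "at (t, \<rho>) within {0..} \<times> {0..}"
  have h: "((\<lambda>z. h (fst z) (snd z)) \<longlongrightarrow> h t \<rho>) ?F"
    using assms tendsto_h tendsto_h_initial by auto
  have fst: "((\<lambda>z. fst z) \<longlongrightarrow> t) ?F"
    using tendsto_fst[OF tendsto_ident_at, of "(t, \<rho>)"] by simp
  have "((\<lambda>z. u (fst z) (snd z)) \<longlongrightarrow> u t \<rho>) ?F"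
  proof (cases "0 < h t \<rho>")
    case True
    then have "0 < h t \<rho> powr (- \<alpha>) + \<alpha> * t"
      using t \<alpha>_pos by (auto simp: add_pos_nonneg)
    then have "((\<lambda>z. b (fst z) (h (fst z) (snd z))) \<longlongrightarrow> b t (h t \<rho>)) ?F"
      unfolding slope_def using True by (intro tendsto_intros h fst) auto
    moreover have "\<forall>\<^sub>F z in ?F. b (fst z) (h (fst z) (snd z)) = u (fst z) (snd z)"
      using eventually_quadrant by eventually_elim (simp add: u_eq_slope)
    moreover have "b t (h t \<rho>) = u t \<rho>"
      using assms by (intro u_eq_slope[symmetric]) auto
    ultimately show ?thesis
      using Lim_transform_eventually by fastforce
  next
    case False
    then have "t = 0" "h t \<rho> = 0"
      using assms h_pos h_nonneg[of t \<rho>] by force+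
    then have "u t \<rho> = 0"
      using u_eq_slope[of t \<rho>] slope_0[of 0] \<rho> by simp
    \<comment> \<open>The negative power in \<open>slope\<close> has no usable limit at slope 0, so
      \<open>u\<close> is squeezed between 0 and \<open>h\<close>.\<close>
    moreover have "((\<lambda>z. u (fst z) (snd z)) \<longlongrightarrow> 0) ?F"
    proof (rule tendsto_sandwich[OF _ _ tendsto_const])
      show "\<forall>\<^sub>F z in ?F. 0 \<le> u (fst z) (snd z)"
        using eventually_quadrant by eventually_elim (simp add: u_nonneg)
      show "\<forall>\<^sub>F z in ?F. u (fst z) (snd z) \<le> h (fst z) (snd z)"
        using eventually_quadrant by eventually_elim (simp add: u_le_h)
    qed (use h \<open>h t \<rho> = 0\<close> in simp)
    ultimately show ?thesis
      by simp
  qed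
  then show ?thesis
    by (simp add: continuous_within case_prod_unfold)
qed

lemma continuous_on_u: "continuous_on ({0<..} \<times> {0..}) (\<lambda>(t, \<rho>). u t \<rho>)"
  unfolding continuous_on_eq_continuous_within
  by (auto intro!: continuous_within_subset[OF continuous_u])

end

section \<open>The mass function as a minimum of explicit solutions\<close>

context characteristics
begin

lemma m_0: "m 0 \<rho> = m0 \<rho>"
  by (simp add: m_sol_def)

lemma m_char_map:
  assumes "0 < t" "(r, \<eta>) \<in> G"
  shows "m t (P t (r, \<eta>)) = m0 r * (1 + \<alpha> * \<eta> powr \<alpha> * t) powr (1 - 1 / \<alpha>)"
  using assms by (simp add: m_sol_def char_inv_char_map)

lemma u_char_map:
  assumes "0 < t" "(r, \<eta>) \<in> G"
  shows "u t (P t (r, \<eta>)) = b t \<eta>"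
  using assms by (simp add: u_sol_def char_inv_char_map slope_def)

lemma m_nonneg:
  assumes "0 \<le> t" "0 \<le> \<rho>"
  shows "0 \<le> m t \<rho>"
proof (cases "t = 0")
  case False
  then obtain r \<eta> where *: "(r, \<eta>) \<in> G" "P t (r, \<eta>) = \<rho>"
    using assms char_invE[of t \<rho>] by (metis order_le_less)
  then show ?thesis
    using m_char_map[of t r \<eta>] assms False by (auto simp: char_dom_iff mass_nonneg)
qed (simp add: m_0 mass_nonneg assms)

text \<open>Characteristics never move left, and \<open>m\<close> does not increase along them
  because \<open>1 - 1 / \<alpha> < 0\<close>. This also bounds the total mass at later
  times.\<close>

lemma m_le_mass:
  assumes "0 \<le> t" "0 \<le> \<rho>"
  shows "m t \<rho> \<le> m0 \<rho>"
proof (cases "t = 0")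
  case False
  then obtain r \<eta> where *: "(r, \<eta>) \<in> G" "P t (r, \<eta>) = \<rho>"
    using assms char_invE[of t \<rho>] by (metis order_le_less)
  then have "m t \<rho> \<le> m0 r"
    using m_char_map[of t r \<eta>] assms False one_plus_powr_le_one[of \<eta> t "1 - 1 / \<alpha>"] \<alpha>_pos \<alpha>_less
    by (auto simp: char_dom_iff mass_nonneg intro!: mult_left_le)
  also have "\<dots> \<le> m0 \<rho>"
    using * char_map_ge[of t r \<eta>] assms by (intro mass_mono) (auto simp: char_dom_iff)
  finally show ?thesis .
qed (simp add: m_0)

text \<open>For fixed \<open>(r, \<eta>)\<close>, the right-hand side is the solution of the equation whose initial value is the
  tangent to \<open>m0\<close> at \<open>r\<close> of slope \<open>\<eta>\<close>; it touches \<open>m\<close> along the characteristic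
  issued from \<open>(r, \<eta>)\<close>.\<close>

lemma m_le_tangent:
  assumes t: "0 \<le> t" and \<rho>: "0 \<le> \<rho>" and G: "(r, \<eta>) \<in> G"
  shows "m t \<rho> \<le> b t \<eta> * (\<rho> - r + m0 r / \<eta>)"
proof -
  have "0 < \<eta>"
    using G by (simp add: char_dom_iff)
  have tangent: "m0 s / \<eta> \<le> s - r + m0 r / \<eta>" if "0 \<le> s" for s
    using mass_le_tangent[OF G that] \<open>0 < \<eta>\<close> by (simp add: field_simps)
  show ?thesis
  proof (cases "t = 0")
    case True
    then show ?thesis
      using mass_le_tangent[OF G \<rho>] \<open>0 < \<eta>\<close> by (simp add: m_0 slope_0 algebra_simps)
  next
    case False
    then have "0 < t"
      using t by simp
    obtain s \<theta> where s: "(s, \<theta>) \<in> G" "P t (s, \<theta>) = \<rho>"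
      using char_invE[OF \<open>0 < t\<close> \<rho>] by metis
    then have "0 < \<theta>" "0 \<le> s"
      by (auto simp: char_dom_iff)
    \<comment> \<open>Normalisation by the slope \<theta> of the characteristic that reaches \<rho>.
      \<open>power_mean_bound\<close> in these variables compares \<open>m t \<rho>\<close> with the
      affine solution through \<open>(s, m0 s)\<close> of initial slope \<eta>; what remains is the
      tangent inequality for \<open>m0\<close> at \<open>s\<close>.\<close>
    define \<tau> where "\<tau> = \<alpha> * \<theta> powr \<alpha> * t"
    define z where "z = \<theta> / \<eta>"
    have "0 \<le> \<tau>" "0 < z"
      using \<alpha>_pos t \<open>0 < \<theta>\<close> \<open>0 < \<eta>\<close> by (auto simp: \<tau>_def z_def)
    have "\<eta> powr (- \<alpha>) + \<alpha> * t = \<theta> powr (- \<alpha>) * (z powr \<alpha> + \<tau>)"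
      using \<open>0 < \<theta>\<close> \<open>0 < \<eta>\<close> by (simp add: z_def \<tau>_def powr_minus powr_divide field_simps)
    then have b: "b t \<eta> = \<theta> * (z powr \<alpha> + \<tau>) powr (- (1 / \<alpha>))"
      using \<alpha>_pos \<open>0 < \<theta>\<close> \<open>0 \<le> \<tau>\<close> by (simp add: slope_def powr_mult powr_powr)
    have "m0 s * \<tau> / \<theta> = \<rho> - s"
      using \<open>0 < \<theta>\<close> s(2)[symmetric] by (simp add: char_map_eq \<tau>_def powr_diff)
    have "m t \<rho> = m0 s * (1 + \<tau>) powr (1 - 1 / \<alpha>)"
      using m_char_map[OF \<open>0 < t\<close> s(1)] by (simp add: s(2) \<tau>_def)
    also have "\<dots> \<le> m0 s * ((z powr \<alpha> + \<tau>) powr (- (1 / \<alpha>)) * (z + \<tau>))"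
      using \<open>0 \<le> s\<close> \<open>0 < z\<close> \<open>0 \<le> \<tau>\<close>
      by (intro mult_left_mono power_mean_bound \<alpha>_pos \<alpha>_less mass_nonneg) auto
    also have "\<dots> = b t \<eta> * (m0 s / \<eta> + m0 s * \<tau> / \<theta>)"
      using \<open>0 < \<theta>\<close> \<open>0 < \<eta>\<close> by (simp add: b z_def field_simps)
    also have "\<dots> = b t \<eta> * (m0 s / \<eta> + (\<rho> - s))"
      by (simp only: \<open>m0 s * \<tau> / \<theta> = \<rho> - s\<close>)
    also have "\<dots> \<le> b t \<eta> * (\<rho> - r + m0 r / \<eta>)"
      using tangent[OF \<open>0 \<le> s\<close>] slope_pos[OF \<open>0 < \<eta>\<close> t] by (intro mult_left_mono) auto
    finally show ?thesis .
  qed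
qed

text \<open>The equality case \<open>z = 1\<close> of \<open>power_mean_bound\<close>, computed
  directly.\<close>

lemma m_eq_tangent:
  assumes t: "0 < t" and G: "(r, \<eta>) \<in> G" and \<rho>: "P t (r, \<eta>) = \<rho>"
  shows "m t \<rho> = b t \<eta> * (\<rho> - r + m0 r / \<eta>)"
proof -
  have "0 < \<eta>"
    using G by (simp add: char_dom_iff)
  define a where "a = 1 + \<alpha> * \<eta> powr \<alpha> * t"
  have "0 < a"
    using \<alpha>_pos t by (simp add: a_def add_pos_nonneg)
  have "\<rho> - r + m0 r / \<eta> = m0 r / \<eta> * a"
    using \<open>0 < \<eta>\<close> by (simp add: \<rho>[symmetric] char_map_eq a_def powr_diff field_simps)
  then have "b t \<eta> * (\<rho> - r + m0 r / \<eta>) = m0 r * (a powr (- (1 / \<alpha>)) * a)"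
    using slope_eq[of \<eta> t] \<open>0 < \<eta>\<close> t by (simp add: a_def)
  also have "a powr (- (1 / \<alpha>)) * a = a powr (1 - 1 / \<alpha>)"
    using \<open>0 < a\<close> by (simp add: powr_diff powr_minus field_simps)
  finally show ?thesis
    using m_char_map[OF t G] by (simp add: \<rho> a_def)
qed

text \<open>The affine solution touching \<open>m\<close> at \<rho> has slope
  \<open>u t \<rho>\<close> and stays above \<open>m t\<close>. Thus \<open>u t \<rho>\<close> is a
  supergradient, and exchanging the two points bounds the increment from the other side.\<close>

lemma m_le_space:
  assumes "0 < t" "0 \<le> \<rho>" "0 \<le> \<rho>'"
  shows "m t \<rho>' \<le> m t \<rho> + u t \<rho> * (\<rho>' - \<rho>)"
proof -
  obtain r \<eta> where *: "(r, \<eta>) \<in> G" "P t (r, \<eta>) = \<rho>"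
    using char_invE[OF assms(1,2)] by metis
  show ?thesis
    using m_le_tangent[of t \<rho>' r \<eta>] m_eq_tangent[of t r \<eta> \<rho>] u_char_map[of t r \<eta>] assms *
    by (simp add: algebra_simps)
qed

text \<open>The affine solution touching \<open>m\<close> at time \<open>t\<close> is followed to
  time \<open>t'\<close>, where it has changed by the factor
  \<open>(D t / D t') powr (1 / \<alpha>)\<close>; Bernoulli's inequality linearises the inverse
  factor. The product form admits both orders of the times, even when the linear factor is
  negative.\<close>

lemma m_le_time:
  assumes t: "0 < t" and t': "0 \<le> t'" and \<rho>: "0 \<le> \<rho>"
  shows "m t' \<rho> * (1 + u t \<rho> powr \<alpha> * (t' - t)) \<le> m t \<rho>"
proof -
  obtain r \<eta> where *: "(r, \<eta>) \<in> G" "P t (r, \<eta>) = \<rho>"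
    using char_invE[OF t \<rho>] by metis
  then have "0 < \<eta>"
    by (simp add: char_dom_iff)
  define D where "D s = \<eta> powr (- \<alpha>) + \<alpha> * s" for s
  have D: "0 < D s" if "0 \<le> s" for s
    using \<alpha>_pos that \<open>0 < \<eta>\<close> by (simp add: D_def add_pos_nonneg)
  have b: "b s \<eta> = D s powr (- (1 / \<alpha>))" for s
    by (simp add: slope_def D_def)
  have "u t \<rho> powr \<alpha> = 1 / D t"
    using u_char_map[OF t *(1)] slope_powr[of \<eta> t] \<open>0 < \<eta>\<close> t by (simp add: * D_def)
  then have "1 + u t \<rho> powr \<alpha> * (t' - t) = 1 + (D t' / D t - 1) / \<alpha>"
    using D[of t] \<alpha>_pos t by (simp add: field_simps) (simp add: D_def algebra_simps)
  also have "\<dots> \<le> (D t' / D t) powr (1 / \<alpha>)"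
    using D t t' by (intro bernoulli_powr \<alpha>_pos \<alpha>_less) auto
  finally have "m t' \<rho> * (1 + u t \<rho> powr \<alpha> * (t' - t)) \<le> m t' \<rho> * (D t' / D t) powr (1 / \<alpha>)"
    by (intro mult_left_mono m_nonneg t' \<rho>)
  also have "\<dots> \<le> (b t' \<eta> * (\<rho> - r + m0 r / \<eta>)) * (D t' / D t) powr (1 / \<alpha>)"
    by (intro mult_right_mono m_le_tangent t' \<rho> *) auto
  also have "\<dots> = b t \<eta> * (\<rho> - r + m0 r / \<eta>)"
    using D[OF t'] D[of t] t by (simp add: b powr_minus powr_divide field_simps)
  also have "\<dots> = m t \<rho>"
    using m_eq_tangent[OF t *] by simp
  finally show ?thesis .
qed

section \<open>Lipschitz bounds and continuity of the mass function\<close>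

lemma m_lipschitz_space:
  assumes "0 \<le> t" "0 \<le> \<rho>" "0 \<le> \<rho>'"
  shows "\<bar>m t \<rho> - m t \<rho>'\<bar> \<le> R 0 * \<bar>\<rho> - \<rho>'\<bar>"
proof (cases "t = 0")
  case True
  then show ?thesis
    using mass_lipschitz assms by (simp add: m_0)
next
  case False
  have *: "m t y - m t x \<le> R 0 * \<bar>x - y\<bar>" if "0 \<le> x" "0 \<le> y" for x y
  proof -
    have "m t y - m t x \<le> u t x * (y - x)"
      using m_le_space[of t x y] assms False that by auto
    also have "\<dots> \<le> u t x * \<bar>x - y\<bar>"
      using u_nonneg[of t x] assms that by (intro mult_left_mono) auto
    also have "\<dots> \<le> R 0 * \<bar>x - y\<bar>"
      using u_le_max[of t x] assms that False by (intro mult_right_mono) auto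
    finally show ?thesis .
  qed
  from *[OF assms(2,3)] *[OF assms(3,2)] show ?thesis
    by (auto simp: abs_minus_commute)
qed

text \<open>The rate \<open>m * u powr \<alpha>\<close> is bounded uniformly down to
  \<open>t = 0\<close>. The decrease is estimated by \<open>m_le_time\<close> based at the later
  time, which is positive; monotonicity from \<open>t = 0\<close> comes from
  \<open>m_le_mass\<close>.\<close>

lemma m_lipschitz_time:
  assumes "0 \<le> t" "0 \<le> t'" "0 \<le> \<rho>"
  shows "\<bar>m t \<rho> - m t' \<rho>\<bar> \<le> R 0 powr \<alpha> * m0 \<rho> * \<bar>t - t'\<bar>"
  using assms
proof (induction t t' rule: linorder_wlog)
  case (le t t')
  show ?case
  proof (cases "t = t'")
    case False
    with le have "0 < t'" "t < t'"
      by auto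
    have "m t' \<rho> \<le> m t \<rho>"
    proof (cases "t = 0")
      case True
      then show ?thesis
        using m_le_mass[of t' \<rho>] le by (simp add: m_0)
    next
      case False
      have "m t' \<rho> * 1 \<le> m t' \<rho> * (1 + u t \<rho> powr \<alpha> * (t' - t))"
        using le m_nonneg[of t' \<rho>] by (intro mult_left_mono) auto
      then show ?thesis
        using m_le_time[of t t' \<rho>] le False by auto
    qed
    have "m t \<rho> - m t' \<rho> \<le> u t' \<rho> powr \<alpha> * m t \<rho> * (t' - t)"
      using m_le_time[of t' t \<rho>] le \<open>0 < t'\<close> by (simp add: algebra_simps)
    also have "\<dots> \<le> R 0 powr \<alpha> * m0 \<rho> * (t' - t)"
      using le \<alpha>_pos \<open>0 < t'\<close> u_le_max u_nonneg
      by (intro mult_right_mono mult_mono powr_mono2 m_le_mass m_nonneg) auto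
    finally show ?thesis
      using \<open>m t' \<rho> \<le> m t \<rho>\<close> \<open>t < t'\<close> by simp
  qed simp
next
  case (sym t t')
  then show ?case
    by (simp add: abs_minus_commute)
qed

lemma continuous_on_m: "continuous_on ({0..} \<times> {0..}) (\<lambda>(t, \<rho>). m t \<rho>)"
proof (clarsimp simp: continuous_on_def case_prod_unfold)
  fix t \<rho> :: real
  assume *: "0 \<le> t" "0 \<le> \<rho>"
  let ?F = "at (t, \<rho>) within {0..} \<times> {0..}"
  show "((\<lambda>z. m (fst z) (snd z)) \<longlongrightarrow> m t \<rho>) ?F"
  proof (rule LIM_zero_cancel, rule Lim_null_comparison)
    show "\<forall>\<^sub>F z in ?F. norm (m (fst z) (snd z) - m t \<rho>)
        \<le> R 0 * \<bar>snd z - \<rho>\<bar> + R 0 powr \<alpha> * m0 \<rho> * \<bar>fst z - t\<bar>"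
      using eventually_quadrant
    proof eventually_elim
      case (elim z)
      then show ?case
        using m_lipschitz_space[of "fst z" "snd z" \<rho>] m_lipschitz_time[of "fst z" t \<rho>] * by simp
    qed
    have "((\<lambda>z. R 0 * \<bar>snd z - \<rho>\<bar> + R 0 powr \<alpha> * m0 \<rho> * \<bar>fst z - t\<bar>) \<longlongrightarrow>
        R 0 * \<bar>snd (t, \<rho>) - \<rho>\<bar> + R 0 powr \<alpha> * m0 \<rho> * \<bar>fst (t, \<rho>) - t\<bar>) ?F"
      by (intro tendsto_intros)
    then show "((\<lambda>z. R 0 * \<bar>snd z - \<rho>\<bar> + R 0 powr \<alpha> * m0 \<rho> * \<bar>fst z - t\<bar>) \<longlongrightarrow> 0) ?F"
      by simp
  qed
qed

section \<open>Partial derivatives and the equation\<close>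

lemma continuous_on_u_space:
  assumes "0 < t"
  shows "continuous_on {0..} (u t)"
proof -
  have "continuous_on {0..} (\<lambda>x. case (t, x) of (t, \<rho>) \<Rightarrow> u t \<rho>)"
    by (rule continuous_on_compose2[OF continuous_on_u]) (use assms in \<open>auto intro!: continuous_intros\<close>)
  then show ?thesis
    by simp
qed

lemma isCont_time:
  assumes "0 < t" "0 \<le> \<rho>"
  shows "isCont (\<lambda>s. u s \<rho>) t" and "isCont (\<lambda>s. m s \<rho>) t"
proof -
  have "continuous_on {0<..} (\<lambda>s. case (s, \<rho>) of (t, \<rho>) \<Rightarrow> u t \<rho>)"
    by (rule continuous_on_compose2[OF continuous_on_u]) (use assms in \<open>auto intro!: continuous_intros\<close>)
  then show "isCont (\<lambda>s. u s \<rho>) t"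
    using assms by (simp add: continuous_on_eq_continuous_at)
  have "continuous_on {0<..} (\<lambda>s. case (s, \<rho>) of (t, \<rho>) \<Rightarrow> m t \<rho>)"
    by (rule continuous_on_compose2[OF continuous_on_m]) (use assms in \<open>auto intro!: continuous_intros\<close>)
  then show "isCont (\<lambda>s. m s \<rho>) t"
    using assms by (simp add: continuous_on_eq_continuous_at)
qed

text \<open>A function with a continuous supergradient is differentiable, one-sidedly at 0.\<close>

lemma m_has_derivative_space:
  assumes "0 < t" "0 \<le> \<rho>"
  shows "(m t has_real_derivative u t \<rho>) (at \<rho> within {0..})"
proof (rule has_real_derivative_sandwich[of "u t" _ _ _ "\<lambda>_. u t \<rho>"])
  show "(u t \<longlongrightarrow> u t \<rho>) (at \<rho> within {0..})"
    using continuous_on_u_space[OF assms(1)] assms(2) by (simp add: continuous_on_def)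
  have "\<forall>\<^sub>F y in at \<rho> within {0..}. 0 \<le> y"
    by (simp add: eventually_at_filter)
  then show "\<forall>\<^sub>F y in at \<rho> within {0..}.
      u t y * (y - \<rho>) \<le> m t y - m t \<rho> \<and> m t y - m t \<rho> \<le> u t \<rho> * (y - \<rho>)"
  proof eventually_elim
    case (elim y)
    then show ?case
      using m_le_space[of t \<rho> y] m_le_space[of t y \<rho>] assms by (simp add: algebra_simps)
  qed
qed simp

text \<open>\<open>m_le_time\<close> based at \<open>t\<close> gives the upper bound and based at
  \<open>s\<close> the lower one. Each leaves one factor at the moving time, so continuity in time
  of both \<open>u\<close> and \<open>m\<close> is needed.\<close>

lemma m_has_derivative_time:
  assumes "0 < t" "0 \<le> \<rho>"
  shows "((\<lambda>s. m s \<rho>) has_real_derivative - (m t \<rho> * u t \<rho> powr \<alpha>)) (at t)"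
proof (rule has_real_derivative_sandwich
    [of "\<lambda>s. - (m t \<rho> * u s \<rho> powr \<alpha>)" _ _ _ "\<lambda>s. - (m s \<rho> * u t \<rho> powr \<alpha>)"])
  note lims = isCont_time[OF assms, unfolded isCont_def]
  show "((\<lambda>s. - (m t \<rho> * u s \<rho> powr \<alpha>)) \<longlongrightarrow> - (m t \<rho> * u t \<rho> powr \<alpha>)) (at t)"
    using u_pos[OF assms] by (intro tendsto_intros lims) auto
  show "((\<lambda>s. - (m s \<rho> * u t \<rho> powr \<alpha>)) \<longlongrightarrow> - (m t \<rho> * u t \<rho> powr \<alpha>)) (at t)"
    by (intro tendsto_intros lims)
  have "\<forall>\<^sub>F s in at t. 0 < s"
    using order_tendstoD(1)[OF tendsto_ident_at assms(1)] .
  then show "\<forall>\<^sub>F s in at t. - (m t \<rho> * u s \<rho> powr \<alpha>) * (s - t) \<le> m s \<rho> - m t \<rho> \<and>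
      m s \<rho> - m t \<rho> \<le> - (m s \<rho> * u t \<rho> powr \<alpha>) * (s - t)"
  proof eventually_elim
    case (elim s)
    then show ?case
      using m_le_time[of t s \<rho>] m_le_time[of s t \<rho>] assms by (simp add: algebra_simps)
  qed
qed

lemma m_classical_solution: "classical_solution \<alpha> m0 m"
  unfolding classical_solution_def
proof (intro conjI, goal_cases)
  case 3
  have "continuous_on ({0<..} \<times> {0..}) (\<lambda>(t, \<rho>). m t \<rho>)"
    by (rule continuous_on_subset[OF continuous_on_m]) auto
  then have "continuous_on ({0<..} \<times> {0..}) (\<lambda>(t, \<rho>). - (m t \<rho> * u t \<rho> powr \<alpha>))"
    unfolding case_prod_unfold
    using continuous_on_u u_pos
    by (intro continuous_intros) (force simp: case_prod_unfold)+
  note * = this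
  show ?case
    by (rule exI[of _ "\<lambda>t \<rho>. - (m t \<rho> * u t \<rho> powr \<alpha>)"], rule exI[of _ u])
       (simp add: * continuous_on_u m_has_derivative_space m_has_derivative_time u_nonneg)
qed (simp_all add: m_0 continuous_on_m)

end

section \<open>Convergence to the initial datum\<close>

text \<open>For \<open>a \<ge> 0\<close> the points whose volume variable is at most
  \<open>a\<close> form a ball of volume \<open>a\<close>. The two measures therefore agree on
  half-lines, which generate the Borel sets.\<close>

lemma distr_volume:
  "distr lborel borel (\<lambda>x::'a::euclidean_space. unit_ball_vol (real DIM('a)) * norm x ^ DIM('a)) =
   density lborel (\<lambda>x. ennreal (indicator {0..} x))"
    (is "distr lborel borel ?V = ?N")
proof (rule measure_eqI_generator_eq[where E = "range (\<lambda>a. {..a::real})" and \<Omega> = UNIV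
      and A = "\<lambda>i. {..real i}"])
  have N: "emeasure ?N {..a} = ennreal a" for a :: real
  proof -
    have "emeasure ?N {..a} = (\<integral>\<^sup>+x. ennreal (indicator {0..} x) * indicator {..a} x \<partial>lborel)"
      by (simp add: emeasure_density)
    also have "\<dots> = (\<integral>\<^sup>+x. indicator {0..a} x \<partial>lborel)"
      by (rule nn_integral_cong) (simp add: indicator_def)
    finally have "emeasure ?N {..a} = (\<integral>\<^sup>+x. indicator {0..a} x \<partial>lborel)" .
    then show ?thesis
      by (cases "0 \<le> a") (auto simp: ennreal_neg)
  qed
  have V: "emeasure (distr lborel borel ?V) {..a} = ennreal a" for a :: real
  proof (cases "0 \<le> a")
    case True
    define \<omega> where "\<omega> = unit_ball_vol (real DIM('a))"
    have "0 < \<omega>"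
      by (simp add: \<omega>_def)
    define r where "r = root DIM('a) (a / \<omega>)"
    have r: "0 \<le> r" "r ^ DIM('a) = a / \<omega>"
      using True \<open>0 < \<omega>\<close> by (auto simp: r_def)
    have "\<omega> * norm x ^ DIM('a) \<le> a \<longleftrightarrow> norm x \<le> r" for x :: 'a
    proof -
      have "\<omega> * norm x ^ DIM('a) \<le> a \<longleftrightarrow> norm x ^ DIM('a) \<le> r ^ DIM('a)"
        using \<open>0 < \<omega>\<close> by (simp add: r field_simps)
      then show ?thesis
        using r(1) by (simp add: power_mono_iff)
    qed
    then have "?V -` {..a} = cball 0 r"
      by (auto simp: \<omega>_def)
    then show ?thesis
      using emeasure_cball[OF r(1), of "0 :: 'a"] r(2) \<open>0 < \<omega>\<close>
      by (simp add: emeasure_distr flip: \<omega>_def)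
  next
    case False
    have "\<not> ?V x \<le> a" for x
    proof -
      have "0 \<le> ?V x"
        by simp
      with False show ?thesis
        by linarith
    qed
    then have "?V -` {..a} = {}"
      by auto
    then show ?thesis
      using False by (simp add: emeasure_distr ennreal_neg)
  qed
  show "emeasure (distr lborel borel ?V) X = emeasure ?N X" if "X \<in> range (\<lambda>a. {..a})" for X
    using that N V by auto
  show "emeasure (distr lborel borel ?V) {..real i} \<noteq> \<infinity>" for i
    using V by simp
  show "(\<Union>i. {..real i}) = UNIV"
    using real_arch_simple by auto
  show "Int_stable (range (\<lambda>a. {..a::real}))"
    by (auto simp: Int_stable_def)
qed (auto simp: borel_eq_atMost)

lemma
  fixes g :: "real \<Rightarrow> real"
  assumes [measurable]: "g \<in> borel_measurable borel"
  shows integrable_radial_iff: "integrable lborel (radial g :: 'a::euclidean_space \<Rightarrow> real)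
      \<longleftrightarrow> set_integrable lborel {0..} g" (is ?I)
    and integral_radial: "(\<integral>x. radial g (x::'a) \<partial>lborel) = (LBINT x:{0..}. g x)" (is ?E)
proof -
  let ?V = "\<lambda>x::'a. unit_ball_vol (real DIM('a)) * norm x ^ DIM('a)"
  have *: "radial g = (\<lambda>x::'a. g (?V x))"
    by (auto simp: radial_def)
  have "integrable lborel (\<lambda>x::'a. g (?V x)) \<longleftrightarrow> integrable (distr lborel borel ?V) g"
    by (intro integrable_distr_eq[symmetric]) auto
  then show ?I
    unfolding * distr_volume set_integrable_def by (simp add: integrable_density)
  have "(\<integral>x. g (?V x) \<partial>lborel) = integral\<^sup>L (distr lborel borel ?V) g"
    by (intro integral_distr[symmetric]) auto
  then show ?E
    unfolding * distr_volume set_lebesgue_integral_def by (simp add: integral_density)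
qed

text \<open>The transfer to the half-line asks for Borel measurability on the whole line. It is
  secured by cutting off the arbitrary values at negative arguments, which \<open>radial\<close>
  never sees.\<close>

lemma radial_restrict: "radial (\<lambda>x. indicator {0..} x *\<^sub>R g x) = radial g"
  by (auto simp: radial_def fun_eq_iff)

context characteristics
begin

section \<open>Integrability of the solution and the L1 limit\<close>

lemma measurable_u0: "(\<lambda>x. indicator {0..} x *\<^sub>R u0 x) \<in> borel_measurable borel"
  using borel_measurable_integrable[OF set_integrable_u0[unfolded set_integrable_def]] by simp

lemma measurable_u: "0 < t \<Longrightarrow> (\<lambda>x. indicator {0..} x *\<^sub>R u t x) \<in> borel_measurable borel"
  by (intro borel_measurable_continuous_on_indicator continuous_on_u_space) auto

text \<open>As \<open>u t\<close> is the derivative of \<open>m t\<close>, its integral over a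
  bounded interval is an increment of \<open>m t\<close>, at most the total mass of
  \<open>u0\<close>. The nonnegative integral is used because integrability is only a
  consequence.\<close>

lemma nn_integral_u_le:
  assumes "0 < t"
  shows "(\<integral>\<^sup>+x. ennreal (indicator {0..} x *\<^sub>R u t x) \<partial>lborel) \<le> ennreal (LBINT x:{0..}. u0 x)"
proof -
  let ?F = "\<lambda>x. indicator {0..} x *\<^sub>R u t x"
  note measurable_u[OF assms, measurable]

  have "(\<integral>\<^sup>+x. ennreal (?F x) \<partial>lborel) = (\<integral>\<^sup>+x. (SUP n. ennreal (?F x) * indicator {..real n} x) \<partial>lborel)"
  proof (rule nn_integral_cong)
    fix x :: real
    obtain n where "x \<le> real n"
      using real_arch_simple by blast
    then have "ennreal (?F x) \<le> (SUP n. ennreal (?F x) * indicator {..real n} x)"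
      by (intro SUP_upper2[of n]) auto
    moreover have "(SUP n. ennreal (?F x) * indicator {..real n} x) \<le> ennreal (?F x)"
      by (intro SUP_least) (auto simp: indicator_def)
    ultimately show "ennreal (?F x) = (SUP n. ennreal (?F x) * indicator {..real n} x)"
      by (rule antisym)
  qed
  also have "\<dots> = (SUP n. \<integral>\<^sup>+x. ennreal (?F x) * indicator {..real n} x \<partial>lborel)"
    by (rule nn_integral_monotone_convergence_SUP, (auto simp: incseq_def le_fun_def indicator_def)[1])
       measurable
  also have "\<dots> \<le> ennreal (LBINT x:{0..}. u0 x)"
  proof (rule SUP_least)
    fix n :: nat
    have "(u t has_integral m t (real n) - m t 0) {0..real n}"
    proof (rule fundamental_theorem_of_calculus)
      fix x assume "x \<in> {0..real n}"
      then have "(m t has_vector_derivative u t x) (at x within {0..})"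
        using m_has_derivative_space[OF assms, of x]
        by (simp add: has_real_derivative_iff_has_vector_derivative)
      then show "(m t has_vector_derivative u t x) (at x within {0..real n})"
        by (rule has_vector_derivative_within_subset) auto
    qed simp
    then have "(\<integral>\<^sup>+x. ennreal (indicator {0..real n} x * u t x) \<partial>lborel) = ennreal (m t (real n) - m t 0)"
      by (rule nn_integral_has_integral_lebesgue[rotated]) (use assms in \<open>simp add: u_nonneg\<close>)
    moreover have "(\<integral>\<^sup>+x. ennreal (?F x) * indicator {..real n} x \<partial>lborel) =
        (\<integral>\<^sup>+x. ennreal (indicator {0..real n} x * u t x) \<partial>lborel)"
      by (intro nn_integral_cong) (auto simp: indicator_def)
    ultimately have "(\<integral>\<^sup>+x. ennreal (?F x) * indicator {..real n} x \<partial>lborel) =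
        ennreal (m t (real n) - m t 0)"
      by simp
    also have "\<dots> \<le> ennreal (LBINT x:{0..}. u0 x)"
      using m_nonneg[of t 0] m_le_mass[of t "real n"] mass_le_total[of "real n"] assms
      by (intro ennreal_leI) auto
    finally show "(\<integral>\<^sup>+x. ennreal (?F x) * indicator {..real n} x \<partial>lborel)
        \<le> ennreal (LBINT x:{0..}. u0 x)" .
  qed
  finally show ?thesis .
qed

lemma
  assumes "0 < t"
  shows set_integrable_u: "set_integrable lborel {0..} (u t)"
    and integral_u_le: "(LBINT x:{0..}. u t x) \<le> (LBINT x:{0..}. u0 x)"
proof -
  let ?F = "\<lambda>x. indicator {0..} x *\<^sub>R u t x"
  have nonneg: "0 \<le> ?F x" for x
    using assms u_nonneg[of t x] by (auto simp: indicator_def)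
  have "0 \<le> (LBINT x:{0..}. u0 x)"
    using mass_le_total[of 0] by (simp add: mass_0)
  show "set_integrable lborel {0..} (u t)"
    unfolding set_integrable_def
    using measurable_u[OF assms] nn_integral_u_le[OF assms] nonneg
    by (intro integrableI_nonneg) (auto intro: le_less_trans)
  then have "ennreal (LBINT x:{0..}. u t x) \<le> ennreal (LBINT x:{0..}. u0 x)"
    using nn_integral_u_le[OF assms] nonneg
    by (simp add: set_lebesgue_integral_def set_integrable_def nn_integral_eq_integral)
  then show "(LBINT x:{0..}. u t x) \<le> (LBINT x:{0..}. u0 x)"
    using \<open>0 \<le> (LBINT x:{0..}. u0 x)\<close> by (simp add: ennreal_le_iff)
qed

text \<open>The monotone \<open>u0\<close> has only countably many discontinuities; at every other
  \<open>x\<close> the joint continuity of \<open>u\<close> at \<open>(0, x)\<close> is restricted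
  to the time direction.\<close>

lemma AE_tendsto_u:
  "AE x in lborel. 0 \<le> x \<longrightarrow> ((\<lambda>t. u t x) \<longlongrightarrow> u0 x) (at_right 0)"
proof -
  have "mono_on {0..} (\<lambda>x. - u0 x)"
    using u0_le by (auto simp: monotone_on_def)
  then have "countable {x \<in> {0..}. \<not> continuous (at x within {0..}) (\<lambda>x. - u0 x)}"
    by (rule mono_on_ctble_discont)
  then have "AE x in lborel. x \<notin> {x \<in> {0..}. \<not> continuous (at x within {0..}) (\<lambda>x. - u0 x)}"
    by (intro AE_not_in countable_imp_null_set_lborel)
  then show ?thesis
  proof eventually_elim
    case (elim x)
    show ?case
    proof
      assume "0 \<le> x"
      with elim have "continuous (at x within {0..}) (\<lambda>x. - u0 x)"
        by simp
      from continuous_minus[OF this] have "continuous (at x within {0..}) u0"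
        by simp
      then have "((\<lambda>(t, \<rho>). u t \<rho>) \<longlongrightarrow> u 0 x) (at (0, x) within {0..} \<times> {0..})"
        using continuous_u[of x 0] \<open>0 \<le> x\<close> by (simp add: continuous_within)
      moreover have "filterlim (\<lambda>t. (t, x)) (at (0::real, x) within {0..} \<times> {0..}) (at_right 0)"
      proof -
        have "\<forall>\<^sub>F t in at_right (0::real). (t, x) \<in> {0..} \<times> {0..} \<and> (t, x) \<noteq> (0, x)"
          by (rule eventually_mono[OF eventually_at_right_less]) (use \<open>0 \<le> x\<close> in simp)
        then show ?thesis
          unfolding filterlim_at by (intro conjI tendsto_intros)
      qed
      ultimately have "((\<lambda>t. case (t, x) of (t, \<rho>) \<Rightarrow> u t \<rho>) \<longlongrightarrow> u 0 x) (at_right 0)"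
        by (rule filterlim_compose)
      then show "((\<lambda>t. u t x) \<longlongrightarrow> u0 x) (at_right 0)"
        by (simp add: u_sol_def)
    qed
  qed
qed

text \<open>Since the integral of \<open>u t\<close> does not exceed that of \<open>u0\<close>, the distance is at most twice the integral of the
  positive part of \<open>u0 - u t\<close>, which is dominated by \<open>u0\<close>.\<close>

lemma u_tendsto_L1: "((\<lambda>t. LBINT x:{0..}. \<bar>u t x - u0 x\<bar>) \<longlongrightarrow> 0) (at_right 0)"
proof (rule tendsto_sandwich[OF _ _ tendsto_const])
  let ?F = "\<lambda>t x. indicator {0..} x *\<^sub>R u t x" and ?G = "\<lambda>x. indicator {0..} x *\<^sub>R u0 x"
  let ?D = "\<lambda>t. \<integral>x. max 0 (?G x - ?F t x) \<partial>lborel"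
  note [measurable] = measurable_u0 measurable_u
  have G: "integrable lborel ?G"
    using set_integrable_u0 by (simp add: set_integrable_def)
  have F: "integrable lborel (?F t)" if "0 < t" for t
    using set_integrable_u[OF that] by (simp add: set_integrable_def)
  show "\<forall>\<^sub>F t in at_right 0. 0 \<le> (LBINT x:{0..}. \<bar>u t x - u0 x\<bar>)"
    by (auto simp: set_lebesgue_integral_def intro!: always_eventually integral_nonneg)
  show "\<forall>\<^sub>F t in at_right 0. (LBINT x:{0..}. \<bar>u t x - u0 x\<bar>) \<le> 2 * ?D t"
    using eventually_at_right_less[of 0]
  proof eventually_elim
    case (elim t)
    \<comment> \<open>Pointwise \<open>|a| = a + 2 * max 0 (- a)\<close> with
      \<open>a = u t x - u0 x\<close>.\<close>
    have "(LBINT x:{0..}. \<bar>u t x - u0 x\<bar>) = (\<integral>x. (?F t x - ?G x) + 2 * max 0 (?G x - ?F t x) \<partial>lborel)"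
      unfolding set_lebesgue_integral_def
      by (intro Bochner_Integration.integral_cong) (auto simp: indicator_def max_def)
    also have "\<dots> = (LBINT x:{0..}. u t x) - (LBINT x:{0..}. u0 x) + 2 * ?D t"
      using F[OF elim] G by (simp add: set_lebesgue_integral_def)
    also have "\<dots> \<le> 2 * ?D t"
      using integral_u_le[OF elim] by simp
    finally show ?case .
  qed
  have "(?D \<longlongrightarrow> 0) (at_right 0)"
    unfolding tendsto_at_iff_sequentially comp_def
  proof (intro allI impI)
    fix X :: "nat \<Rightarrow> real"
    assume "\<forall>i. X i \<in> {0<..} - {0}" "X \<longlonglongrightarrow> 0"
    then have X: "0 < X i" for i
      by auto
    then have lim: "filterlim X (at_right 0) sequentially"
      using \<open>X \<longlonglongrightarrow> 0\<close> X by (auto simp: filterlim_at less_imp_neq[OF X, symmetric])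
    have "(\<lambda>i. \<integral>x. max 0 (?G x - ?F (X i) x) \<partial>lborel) \<longlonglongrightarrow> (\<integral>x. 0 \<partial>(lborel :: real measure))"
    proof (rule integral_dominated_convergence[where w = ?G])
      show "AE x in lborel. norm (max 0 (?G x - ?F (X i) x)) \<le> ?G x" for i
        using X[of i] by (auto intro!: AE_I2 simp: indicator_def u0_nonneg u_nonneg)
      show "AE x in lborel. (\<lambda>i. max 0 (?G x - ?F (X i) x)) \<longlonglongrightarrow> 0"
        using AE_tendsto_u
      proof eventually_elim
        case (elim x)
        show ?case
        proof (cases "0 \<le> x")
          case True
          then have "(\<lambda>i. u (X i) x) \<longlonglongrightarrow> u0 x"
            using filterlim_compose[OF _ lim] elim by auto
          then have "(\<lambda>i. max 0 (u0 x - u (X i) x)) \<longlonglongrightarrow> max 0 (u0 x - u0 x)"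
            by (intro tendsto_intros)
          with True show ?thesis
            by simp
        qed simp
      qed
      show "(\<lambda>x. max 0 (?G x - ?F (X i) x)) \<in> borel_measurable lborel" for i
        using measurable_u[OF X[of i]] measurable_u0 by simp
    qed (use G in auto)
    then show "(\<lambda>i. ?D (X i)) \<longlonglongrightarrow> 0"
      by simp
  qed
  then show "((\<lambda>t. 2 * ?D t) \<longlongrightarrow> 0) (at_right 0)"
    using tendsto_mult_right_zero by blast
qed

lemma radial_u_tendsto_L1:
  "tendsto_L1 lborel (\<lambda>t. radial (u t)) (radial u0 :: 'a::euclidean_space \<Rightarrow> real) (at_right 0)"
  unfolding tendsto_L1_def
proof (intro conjI)
  let ?F = "\<lambda>t x. indicator {0..} x *\<^sub>R u t x" and ?G = "\<lambda>x. indicator {0..} x *\<^sub>R u0 x"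
  have restrict: "set_integrable lborel {0..} (\<lambda>x. indicator {0..} x *\<^sub>R g x) = set_integrable lborel {0..} g"
    for g :: "real \<Rightarrow> real"
    unfolding set_integrable_def by (intro Bochner_Integration.integrable_cong) (auto simp: indicator_def)
  show "integrable lborel (radial u0 :: 'a \<Rightarrow> real)"
    using integrable_radial_iff[OF measurable_u0, where 'a = 'a] set_integrable_u0 restrict
    by (simp only: radial_restrict)
  show "\<forall>\<^sub>F t in at_right 0. integrable lborel (radial (u t) :: 'a \<Rightarrow> real)"
    using eventually_at_right_less[of 0]
  proof eventually_elim
    case (elim t)
    then show ?case
      using integrable_radial_iff[OF measurable_u[OF elim], where 'a = 'a] set_integrable_u[OF elim] restrict
      by (simp only: radial_restrict)
  qed
  have "\<forall>\<^sub>F t in at_right 0. (LBINT x:{0..}. \<bar>u t x - u0 x\<bar>) =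
      (\<integral>x. \<bar>radial (u t) (x::'a) - radial u0 x\<bar> \<partial>lborel)"
    using eventually_at_right_less[of 0]
  proof eventually_elim
    case (elim t)
    have "(\<lambda>x. \<bar>?F t x - ?G x\<bar>) \<in> borel_measurable borel"
      using measurable_u[OF elim] measurable_u0 by simp
    from integral_radial[OF this, where 'a = 'a]
    have "(\<integral>x. radial (\<lambda>x. \<bar>?F t x - ?G x\<bar>) (x::'a) \<partial>lborel) = (LBINT x:{0..}. \<bar>?F t x - ?G x\<bar>)" .
    also have "\<dots> = (LBINT x:{0..}. \<bar>u t x - u0 x\<bar>)"
      by (intro set_lebesgue_integral_cong) auto
    finally show ?case
      by (simp add: radial_def)
  qed
  then show "((\<lambda>t. \<integral>x. \<bar>radial (u t) (x::'a) - radial u0 x\<bar> \<partial>lborel) \<longlongrightarrow> 0) (at_right 0)"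
    by (rule Lim_transform_eventually[OF u_tendsto_L1])
qed

end

theorem proposition4p2:
  fixes \<alpha> :: real and u0 :: "real \<Rightarrow> real"
  assumes "0 < \<alpha>" and "\<alpha> < 1"
    and "set_integrable lborel {0..} u0"
    and "\<exists>C. AE \<rho> in lborel. 0 \<le> \<rho> \<longrightarrow> \<bar>u0 \<rho>\<bar> \<le> C"
    and "\<forall>\<rho>\<ge>0. 0 \<le> u0 \<rho>"
    and "\<not> (AE \<rho> in lborel. 0 \<le> \<rho> \<longrightarrow> u0 \<rho> = 0)"
    and "antimono_on {0..} u0"
  shows
    "(\<forall>t>0. bij_betw (char_map \<alpha> u0 t) (char_dom u0) {0..}) \<and>
     (\<forall>t>0. \<forall>(\<rho>0, \<eta>0)\<in>char_dom u0.
        u_sol \<alpha> u0 t (char_map \<alpha> u0 t (\<rho>0, \<eta>0))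
          = (\<eta>0 powr (- \<alpha>) + \<alpha> * t) powr (- (1 / \<alpha>))) \<and>
     continuous_on ({0<..} \<times> {0..}) (\<lambda>(t, \<rho>). u_sol \<alpha> u0 t \<rho>) \<and>
     (\<forall>\<rho>\<ge>0. continuous (at \<rho> within {0..}) u0 \<longrightarrow>
        continuous (at (0, \<rho>) within {0..} \<times> {0..}) (\<lambda>(t, \<rho>). u_sol \<alpha> u0 t \<rho>)) \<and>
     (continuous_on {0..} u0 \<longrightarrow>
        continuous_on ({0..} \<times> {0..}) (\<lambda>(t, \<rho>). u_sol \<alpha> u0 t \<rho>)) \<and>
     tendsto_L1 lborel (\<lambda>t. radial (u_sol \<alpha> u0 t)) (radial u0 :: 'a::euclidean_space \<Rightarrow> real)
       (at_right 0) \<and>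
     (\<forall>t>0. \<forall>(\<rho>0, \<eta>0)\<in>char_dom u0.
        m_sol \<alpha> u0 t (char_map \<alpha> u0 t (\<rho>0, \<eta>0))
          = mass u0 \<rho>0 * (1 + \<alpha> * \<eta>0 powr \<alpha> * t) powr (1 - 1 / \<alpha>)) \<and>
     classical_solution \<alpha> (mass u0) (m_sol \<alpha> u0) \<and>
     (\<forall>t>0. \<forall>\<rho>\<ge>0.
        (m_sol \<alpha> u0 t has_real_derivative u_sol \<alpha> u0 t \<rho>) (at \<rho> within {0..}))"
proof -
  interpret characteristics u0 \<alpha>
    by unfold_locales (use assms in auto)
  have "continuous_on ({0..} \<times> {0..}) (\<lambda>(t, \<rho>). u t \<rho>)" if "continuous_on {0..} u0"
    unfolding continuous_on_eq_continuous_within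
  proof
    fix z :: "real \<times> real"
    assume "z \<in> {0..} \<times> {0..}"
    then obtain t \<rho> where "z = (t, \<rho>)" "0 \<le> t" "0 \<le> \<rho>"
      by auto
    with that show "continuous (at z within {0..} \<times> {0..}) (\<lambda>(t, \<rho>). u t \<rho>)"
      using continuous_u[of \<rho> t] by (cases "t = 0") (auto simp: continuous_on_eq_continuous_within)
  qed
  then show ?thesis
    using char_map_bij u_char_map continuous_on_u continuous_u radial_u_tendsto_L1 m_char_map
      m_classical_solution m_has_derivative_space
    by (auto simp: slope_def)
qed

end
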